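(* Let $M=M(T)$ be an $N_1\times N_2$ matrix whose entries are homogeneous degree-$d$ polynomials in the entries of a tensor $T\in\mathbb{R}^{n_1\times\cdots\times n_k}$. Set $T=\sum_{\ell=1}^r T^{(\ell)}$ and, viewing the entries of $M(T)$ as homogeneous degree-$d$ polynomials in the entries of $T^{(1)},\dots,T^{(r)}$, write uniquely $$M=M_{\mathrm{rep}}+\sum_{1\le\ell_1<\cdots<\ell_d\le r}\tilde M(T^{(\ell_1)},\dots,T^{(\ell_d)}),$$ where $\tilde M$ has entries that are homogeneous of degree 1 in each of its $d$ input tensors and $M_{\mathrm{rep}}$ consists of those monomials involving fewer than $d$ of the tensors $T^{(1)},\dots,T^{(r)}$. Suppose that for $T^{(\ell)}=a^{(1,\ell)}\otimes\cdots\otimes a^{(k,\ell)}$ with generically chosen components $a^{(i,\ell)}\in\mathbb{R}^{n_i}$, $$\mathrm{rank}\Big(\sum_{1\le\ell_1<\cdots<\ell_d\le r}\tilde M(T^{(\ell_1)},\dots,T^{(\ell_d)})\Big)=\binom{r}{d}\cdot\mathrm{rank}\big(\tilde M(T^{(1)},\dots,T^{(d)})\big).$$ Then $r\le 4^k d^2 n_*$, where $n_*:=\max_{S\subseteq[k]}\min\{\prod_{i\in S}n_i,\prod_{i\in[k]\setminus S}n_i\}$.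
   Context: "Generically chosen" means: the identity holds for all choices of the components outside the zero set of some nonidentically-zero polynomial in all coordinates of the components $a^{(i,\ell)}$.
   Formalization: The formal theorem assumes in addition that d ≥ 1 and that M is not identically zero; for M = 0 the rank identity reads 0 = 0 for every r, and for d = 0 it holds for every r while the bound is 0, so the statement fails without these assumptions. *)

theory Defs
  imports "HOL-Analysis.Analysis" "HOL-Library.Poly_Mapping"
begin

type_synonym 'v rpoly = "('v \<Rightarrow>\<^sub>0 nat) \<Rightarrow>\<^sub>0 real"

definition Var :: "'v \<Rightarrow> 'v rpoly" where
  "Var v = Poly_Mapping.single (Poly_Mapping.single v 1) 1"

definition Const :: "real \<Rightarrow> 'v rpoly" where
  "Const c = Poly_Mapping.single 0 c"

definition vars :: "'v rpoly \<Rightarrow> 'v set" where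
  "vars p = (\<Union>m\<in>Poly_Mapping.keys p. Poly_Mapping.keys m)"

definition peval :: "('v \<Rightarrow> real) \<Rightarrow> 'v rpoly \<Rightarrow> real" where
  "peval x p = (\<Sum>m\<in>Poly_Mapping.keys p. Poly_Mapping.lookup p m *
     (\<Prod>v\<in>Poly_Mapping.keys m. x v ^ Poly_Mapping.lookup m v))"

definition psubst :: "('v \<Rightarrow> 'w rpoly) \<Rightarrow> 'v rpoly \<Rightarrow> 'w rpoly" where
  "psubst \<sigma> p = (\<Sum>m\<in>Poly_Mapping.keys p. Const (Poly_Mapping.lookup p m) *
     (\<Prod>v\<in>Poly_Mapping.keys m. \<sigma> v ^ Poly_Mapping.lookup m v))"

definition homogeneous :: "nat \<Rightarrow> 'v rpoly \<Rightarrow> bool" where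
  "homogeneous d p \<longleftrightarrow>
     (\<forall>m\<in>Poly_Mapping.keys p. (\<Sum>v\<in>Poly_Mapping.keys m. Poly_Mapping.lookup m v) = d)"

text \<open>All indices are counted from 0. An entry of a tensor of format
  \<open>n 0 \<times> \<dots> \<times> n (k - 1)\<close> is addressed by a multi-index \<open>j\<close>; the polynomial variable for that
  entry is \<open>j\<close> itself, and for that entry of the \<open>l\<close>-th of several tensors it is \<open>(l, j)\<close>.\<close>

definition multi_indices :: "nat \<Rightarrow> (nat \<Rightarrow> nat) \<Rightarrow> (nat \<Rightarrow> nat) set" where
  "multi_indices k n = (\<Pi>\<^sub>E i\<in>{..<k}. {..<n i})"

definition rank_one_tensor :: "nat \<Rightarrow> (nat \<Rightarrow> nat \<Rightarrow> real) \<Rightarrow> (nat \<Rightarrow> nat) \<Rightarrow> real" where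
  "rank_one_tensor k a j = (\<Prod>i<k. a i (j i))"

definition increasing_tuples :: "nat \<Rightarrow> nat \<Rightarrow> (nat \<Rightarrow> nat) set" where
  "increasing_tuples d r = {l \<in> {..<d} \<rightarrow>\<^sub>E {..<r}. strict_mono_on {..<d} l}"

definition expand_sum :: "nat \<Rightarrow> 'j rpoly \<Rightarrow> (nat \<times> 'j) rpoly" where
  "expand_sum r = psubst (\<lambda>j. \<Sum>l<r. Var (l, j))"

text \<open>Plug the tensors number \<open>l 0, \<dots>, l (d - 1)\<close> into a polynomial in \<open>d\<close> tensors.\<close>

definition select_tensors :: "(nat \<Rightarrow> nat) \<Rightarrow> (nat \<times> 'j) rpoly \<Rightarrow> (nat \<times> 'j) rpoly" where
  "select_tensors l = psubst (\<lambda>(s, j). Var (l s, j))"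

definition multi_homogeneous_1 :: "nat \<Rightarrow> 'j set \<Rightarrow> (nat \<times> 'j) rpoly \<Rightarrow> bool" where
  "multi_homogeneous_1 d J p \<longleftrightarrow> vars p \<subseteq> {..<d} \<times> J \<and>
     (\<forall>m\<in>Poly_Mapping.keys p. \<forall>s<d. (\<Sum>j\<in>J. Poly_Mapping.lookup m (s, j)) = 1)"

definition involves_fewer_tensors :: "nat \<Rightarrow> nat \<Rightarrow> 'j set \<Rightarrow> (nat \<times> 'j) rpoly \<Rightarrow> bool" where
  "involves_fewer_tensors d r J p \<longleftrightarrow> vars p \<subseteq> {..<r} \<times> J \<and>
     (\<forall>m\<in>Poly_Mapping.keys p. card (fst ` Poly_Mapping.keys m) < d)"

definition tensor_decomposition ::
  "nat \<Rightarrow> nat \<Rightarrow> 'j set \<Rightarrow> 'j rpoly ^ 'n2 ^ 'n1 \<Rightarrow>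
   (nat \<times> 'j) rpoly ^ 'n2 ^ 'n1 \<Rightarrow> (nat \<times> 'j) rpoly ^ 'n2 ^ 'n1 \<Rightarrow> bool" where
  "tensor_decomposition d r J M Mrep Mt \<longleftrightarrow>
     (\<forall>i j. involves_fewer_tensors d r J (Mrep $ i $ j)) \<and>
     (\<forall>i j. multi_homogeneous_1 d J (Mt $ i $ j)) \<and>
     map_matrix (expand_sum r) M =
       Mrep + (\<Sum>l\<in>increasing_tuples d r. map_matrix (select_tensors l) Mt)"

text \<open>Outside the zero set of a nonzero polynomial in the coordinates \<open>V\<close>.\<close>

definition generically :: "'v set \<Rightarrow> (('v \<Rightarrow> real) \<Rightarrow> bool) \<Rightarrow> bool" where
  "generically V P \<longleftrightarrow>
     (\<exists>q :: 'v rpoly. q \<noteq> 0 \<and> vars q \<subseteq> V \<and> (\<forall>x. peval x q \<noteq> 0 \<longrightarrow> P x))"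

definition n_star :: "nat \<Rightarrow> (nat \<Rightarrow> nat) \<Rightarrow> nat" where
  "n_star k n = Max ((\<lambda>S. min (\<Prod>i\<in>S. n i) (\<Prod>i\<in>{..<k} - S. n i)) ` Pow {..<k})"

end

theory Submission
  imports Defs "HOL-Computational_Algebra.Polynomial"
begin

text \<open>
  Choose the components generically so that moreover \<open>\<rho> = rank M~(T\<^sub>0, \<dots>, T\<^bsub>d-1\<^esub>)\<close> is maximal among
  rank-one arguments. All \<open>r choose d\<close> summands have rank at most \<open>\<rho>\<close>, so equality forces the rank to
  be additive on every subset of summands, in particular on those containing \<open>0, \<dots>, d - 2\<close>. These add
  up to a matrix that is linear in \<open>T\<^bsub>d-1\<^esub> + \<dots> + T\<^bsub>r-1\<^esub>\<close>, and it remains to bound its rank.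

  Let \<open>F(a)\<close> be multilinear in \<open>a = (a\<^sub>1, \<dots>, a\<^sub>k)\<close> with rank at most \<open>\<rho>\<close>. Near a point \<open>a\<^sub>0\<close> of maximal
  rank, \<open>F = F X B\<^sup>-\<^sup>1 F\<close> with a fixed matrix \<open>X\<close> of that rank and \<open>B\<close> affine in \<open>F\<close>. Comparing the
  mixed derivatives at \<open>a\<^sub>0\<close> in the directions \<open>b\<^sub>i\<close> writes \<open>F(b)\<close> as a sum over \<open>S \<subseteq> [k]\<close> of
  \<open>U\<^sub>S(b) X V\<^sub>S(b)\<close>, where \<open>U\<^sub>S\<close> depends multilinearly on the \<open>b\<^sub>i\<close> with \<open>i \<in> S\<close> and \<open>V\<^sub>S\<close> on the others.
  For each \<open>S\<close> the sum over arbitrarily many \<open>b\<close> has rank at most \<open>n\<^sub>* \<rho>\<close>, so the total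
  is at most \<open>2\<^sup>k n\<^sub>* \<rho>\<close>; hence \<open>r - d + 1 \<le> 2\<^sup>k n\<^sub>*\<close>.
\<close>

section \<open>Rank and inverse of real matrices\<close>

lemma rank_add_le:
  fixes A B :: "real^'n^'m"
  shows "rank (A + B) \<le> rank A + rank B"
proof -
  let ?S = "range ((*v) A)" and ?T = "range ((*v) B)"
  have "rank (A + B) \<le> dim {x + y |x y. x \<in> ?S \<and> y \<in> ?T}"
    unfolding rank_dim_range
    by (rule dim_subset) (auto simp: matrix_vector_mult_add_rdistrib)
  also have "\<dots> \<le> rank A + rank B"
    using dim_sums_Int[of ?S ?T]
    by (simp add: rank_dim_range linear_subspace_image)
  finally show ?thesis .
qed

lemma rank_sum_le:
  fixes A :: "'i \<Rightarrow> real^'n^'m"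
  assumes "\<And>i. i \<in> I \<Longrightarrow> rank (A i) \<le> c i"
  shows "rank (sum A I) \<le> sum c I"
  using assms
proof (induction I rule: infinite_finite_induct)
  case (insert i I)
  then show ?case
    using rank_add_le[of "A i" "sum A I"] by (simp add: add_mono order_trans)
qed auto

text \<open>A linear right inverse \<open>g\<close> of \<open>A\<close> on its range yields
  \<open>G\<close> with \<open>A ** G ** A = A\<close>. Passing to \<open>G ** A ** G\<close> keeps
  this identity and adds the other two properties.\<close>

lemma matrix_generalized_inverse:
  fixes A :: "real^'n^'m"
  obtains X :: "real^'m^'n" where "A ** X ** A = A" "X ** A ** X = X" "rank X \<le> rank A"
proof -
  obtain g where g: "linear g" "\<And>v. A *v (g (A *v v)) = A *v v"
    using linear_exists_right_inverse_on[OF matrix_vector_mul_linear[of A] subspace_UNIV]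
    by auto
  define G where "G = matrix g"
  have AGA: "A ** G ** A = A"
    using g by (simp add: matrix_eq G_def flip: matrix_vector_mul_assoc)
  have "G ** A ** G ** A = G ** A"
    by (metis AGA matrix_mul_assoc)
  then have "G ** A ** G ** A ** (G ** A ** G) = G ** A ** G"
    by (metis matrix_mul_assoc)
  moreover have "rank (G ** A ** G) \<le> rank A"
    using rank_mul_le_left rank_mul_le_right order_trans by blast
  ultimately show ?thesis
    using that[of "G ** A ** G"] AGA by (simp add: matrix_mul_assoc)
qed

lemma bounded_bilinear_matrix_matrix_mult:
  "bounded_bilinear ((**) :: real^'n^'m \<Rightarrow> real^'p^'n \<Rightarrow> real^'p^'m)"
  by (auto simp: bilinear_conv_bounded_bilinear[symmetric] bilinear_def vec_eq_iff
      matrix_matrix_mult_def sum.distrib algebra_simps sum_distrib_left intro!: linearI)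

lemmas matrix_add_rdistrib = bounded_bilinear.add_left[OF bounded_bilinear_matrix_matrix_mult]
lemmas matrix_diff_ldistrib = bounded_bilinear.diff_right[OF bounded_bilinear_matrix_matrix_mult]
lemmas matrix_diff_rdistrib = bounded_bilinear.diff_left[OF bounded_bilinear_matrix_matrix_mult]
lemmas matrix_mult_sum_left = bounded_bilinear.sum_left[OF bounded_bilinear_matrix_matrix_mult]
lemmas matrix_mult_sum_right = bounded_bilinear.sum_right[OF bounded_bilinear_matrix_matrix_mult]
lemmas matrix_mult_scaleR_left = bounded_bilinear.scaleR_left[OF bounded_bilinear_matrix_matrix_mult]
lemmas matrix_mult_scaleR_right = bounded_bilinear.scaleR_right[OF bounded_bilinear_matrix_matrix_mult]
lemmas has_vector_derivative_matrix_mult =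
  bounded_bilinear.has_vector_derivative[OF bounded_bilinear_matrix_matrix_mult]

section \<open>Continuity and derivative of the matrix inverse\<close>

lemma matrix_inv_mult:
  fixes A :: "real^'n^'n"
  assumes "det A \<noteq> 0"
  shows "A ** matrix_inv A = mat 1" "matrix_inv A ** A = mat 1"
  using assms someI_ex[of "\<lambda>B. A ** B = mat 1 \<and> B ** A = mat 1"]
  unfolding invertible_det_nz[symmetric] invertible_def matrix_inv_def by auto

lemma tendsto_det:
  fixes B :: "'x \<Rightarrow> real^'n^'n"
  assumes "(B \<longlongrightarrow> B0) F"
  shows "((\<lambda>z. det (B z)) \<longlongrightarrow> det B0) F"
  unfolding det_def by (intro tendsto_intros assms)

text \<open>Cramer's rule for the columns of the inverse: every entry is a quotient of determinants,
  from which continuity of inversion is read off.\<close>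

lemma matrix_inv_cramer:
  fixes A :: "real^'n^'n"
  assumes "det A \<noteq> 0"
  shows "matrix_inv A $ k $ l = det (\<chi> i j. if j = k then axis l 1 $ i else A $ i $ j) / det A"
proof -
  have "A *v (matrix_inv A *v axis l 1) = axis l 1"
    by (simp add: matrix_vector_mul_assoc matrix_inv_mult[OF assms])
  then have "(matrix_inv A *v axis l 1) $ k
      = det (\<chi> i j. if j = k then axis l 1 $ i else A $ i $ j) / det A"
    using cramer[OF assms] by (simp add: vec_eq_iff)
  then show ?thesis
    by (simp add: matrix_vector_mult_basis column_def)
qed

lemma tendsto_matrix_inv:
  fixes B :: "'x \<Rightarrow> real^'n^'n"
  assumes B: "(B \<longlongrightarrow> B0) F" and det: "det B0 \<noteq> 0"
  shows "((\<lambda>z. matrix_inv (B z)) \<longlongrightarrow> matrix_inv B0) F"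
proof (intro vec_tendstoI)
  fix k l
  have "((\<lambda>z. det (\<chi> i j. if j = k then axis l 1 $ i else B z $ i $ j) / det (B z))
      \<longlongrightarrow> det (\<chi> i j. if j = k then axis l 1 $ i else B0 $ i $ j) / det B0) F"
    by (intro tendsto_divide tendsto_det B det vec_tendstoI) (auto intro!: tendsto_intros B)
  moreover have "\<forall>\<^sub>F z in F. det (B z) \<noteq> 0"
    using tendsto_imp_eventually_ne[OF tendsto_det[OF B] det] .
  then have "\<forall>\<^sub>F z in F. det (\<chi> i j. if j = k then axis l 1 $ i else B z $ i $ j) / det (B z)
      = matrix_inv (B z) $ k $ l"
    by eventually_elim (simp add: matrix_inv_cramer)
  ultimately show "((\<lambda>z. matrix_inv (B z) $ k $ l) \<longlongrightarrow> matrix_inv B0 $ k $ l) F"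
    unfolding matrix_inv_cramer[OF det, of k l] by (rule Lim_transform_eventually)
qed

lemma has_vector_derivative_at_0_iff_tendsto:
  fixes f :: "real \<Rightarrow> 'a::real_normed_vector"
  shows "(f has_vector_derivative D) (at 0) \<longleftrightarrow>
    ((\<lambda>z. inverse z *\<^sub>R (f z - f 0)) \<longlongrightarrow> D) (at 0)"
proof -
  have "norm (f z - f 0 - z *\<^sub>R D) / \<bar>z\<bar> = norm (inverse z *\<^sub>R (f z - f 0) - D)"
    if "z \<noteq> 0" for z
  proof -
    have "inverse z *\<^sub>R (f z - f 0) - D = inverse z *\<^sub>R (f z - f 0 - z *\<^sub>R D)"
      using that by (simp add: scaleR_right_diff_distrib)
    then show ?thesis
      by (simp add: divide_inverse_commute)
  qed
  then have "((\<lambda>z. norm (f z - f 0 - z *\<^sub>R D) / \<bar>z\<bar>) \<longlongrightarrow> 0) (at 0) \<longleftrightarrow>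
      ((\<lambda>z. norm (inverse z *\<^sub>R (f z - f 0) - D)) \<longlongrightarrow> 0) (at 0)"
    by (intro filterlim_cong refl) (simp add: eventually_at_filter)
  then show ?thesis
    by (simp add: has_vector_derivative_def has_derivative_iff_norm bounded_linear_scaleR_left
        tendsto_norm_zero_iff LIM_zero_iff)
qed

text \<open>The resolvent identity turns the difference quotient into
  \<open>- (matrix_inv (?B z) ** B1 ** matrix_inv B0)\<close>, and continuity of inversion gives its
  limit.\<close>

lemma has_vector_derivative_matrix_inv:
  fixes B0 B1 :: "real^'n^'n"
  assumes det: "det B0 \<noteq> 0"
  shows "((\<lambda>z. matrix_inv (B0 + z *\<^sub>R B1)) has_vector_derivative
    - (matrix_inv B0 ** B1 ** matrix_inv B0)) (at 0)"
  unfolding has_vector_derivative_at_0_iff_tendsto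
proof (rule Lim_transform_eventually)
  let ?B = "\<lambda>z. B0 + z *\<^sub>R B1"
  have "(?B \<longlongrightarrow> B0 + 0 *\<^sub>R B1) (at 0)"
    by (intro tendsto_intros)
  then have lim: "(?B \<longlongrightarrow> B0) (at 0)"
    by simp
  show "((\<lambda>z. - (matrix_inv (?B z) ** B1 ** matrix_inv B0)) \<longlongrightarrow>
      - (matrix_inv B0 ** B1 ** matrix_inv B0)) (at 0)"
    by (intro tendsto_intros bounded_bilinear.tendsto[OF bounded_bilinear_matrix_matrix_mult]
        tendsto_matrix_inv lim det)
  have "\<forall>\<^sub>F z in at 0. det (?B z) \<noteq> 0"
    using tendsto_imp_eventually_ne[OF tendsto_det[OF lim] det] .
  moreover have "\<forall>\<^sub>F z in at (0::real). z \<noteq> 0"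
    by (simp add: eventually_at_filter)
  ultimately show "\<forall>\<^sub>F z in at 0. - (matrix_inv (?B z) ** B1 ** matrix_inv B0)
      = inverse z *\<^sub>R (matrix_inv (?B z) - matrix_inv (?B 0))"
  proof eventually_elim
    case (elim z)
    have "matrix_inv (?B z) - matrix_inv B0
        = matrix_inv (?B z) ** (B0 - ?B z) ** matrix_inv B0"
      by (simp only: matrix_diff_ldistrib matrix_diff_rdistrib matrix_inv_mult[OF elim(1)]
          matrix_mul_lid matrix_mul_rid matrix_mul_assoc[symmetric] matrix_inv_mult[OF det])
    also have "\<dots> = - (z *\<^sub>R (matrix_inv (?B z) ** B1 ** matrix_inv B0))"
      by (simp add: matrix_mult_scaleR_left matrix_mult_scaleR_right
          bounded_bilinear.minus_left[OF bounded_bilinear_matrix_matrix_mult]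
          bounded_bilinear.minus_right[OF bounded_bilinear_matrix_matrix_mult])
    finally show ?case
      using elim by simp
  qed
qed

text \<open>With the projection \<open>P = A0 ** X\<close> and \<open>B = A ** X + (mat 1 - P)\<close> one has \<open>B ** P = A ** X\<close>;
  hence if \<open>A\<close> has no larger rank than \<open>A0\<close>, the columns of \<open>B\<^sup>-\<^sup>1 ** A\<close> lie in the range of \<open>P\<close>.\<close>

lemma rank_perturbation:
  fixes A A0 :: "real^'n^'m" and X :: "real^'m^'n"
  assumes X: "A0 ** X ** A0 = A0" "X ** A0 ** X = X"
    and det: "det (A ** X + (mat 1 - A0 ** X)) \<noteq> 0"
  shows "rank A0 \<le> rank (A ** X)"
    and "rank A \<le> rank A0 \<Longrightarrow>
      A0 ** X ** (matrix_inv (A ** X + (mat 1 - A0 ** X)) ** A)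
      = matrix_inv (A ** X + (mat 1 - A0 ** X)) ** A"
proof -
  define P where "P = A0 ** X"
  define B where "B = A ** X + (mat 1 - P)"
  have inv: "matrix_inv B ** B = mat 1"
    using det by (simp add: B_def P_def matrix_inv_mult)
  have PP: "P ** P = P"
    unfolding P_def by (metis X(1) matrix_mul_assoc)
  have "X ** P = X"
    using X(2) by (simp add: P_def matrix_mul_assoc)
  then have BP: "B ** P = A ** X"
    by (simp add: B_def matrix_add_rdistrib matrix_diff_rdistrib PP flip: matrix_mul_assoc)
  have "rank A0 \<le> rank P"
    using rank_mul_le_left[of P A0] X(1) by (simp add: P_def)
  also have "P = matrix_inv B ** (A ** X)"
    by (metis BP inv matrix_mul_assoc matrix_mul_lid)
  finally show le: "rank A0 \<le> rank (A ** X)"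
    using rank_mul_le_right order_trans by blast
  assume "rank A \<le> rank A0"
  \<comment> \<open>The chain \<open>rank A \<le> rank A0 \<le> rank (A ** X)\<close> upgrades this
    inclusion of ranges to an equality.\<close>
  have sub: "range ((*v) (A ** X)) \<subseteq> range ((*v) A)"
    by (auto simp flip: matrix_vector_mul_assoc)
  have "range ((*v) (A ** X)) = range ((*v) A)"
    by (rule subspace_dim_equal[OF _ _ sub])
      (use le \<open>rank A \<le> rank A0\<close> in \<open>auto simp: rank_dim_range linear_subspace_image\<close>)
  then have "\<exists>w. A *v v = (B ** P) *v w" for v
    unfolding BP by (metis rangeE rangeI)
  then have "P *v (matrix_inv B *v (A *v v)) = matrix_inv B *v (A *v v)" for v
    by (metis PP inv matrix_mul_assoc matrix_mul_lid matrix_vector_mul_assoc)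
  then show "A0 ** X ** (matrix_inv (A ** X + (mat 1 - A0 ** X)) ** A)
      = matrix_inv (A ** X + (mat 1 - A0 ** X)) ** A"
    unfolding P_def[symmetric] B_def[symmetric]
    by (simp add: matrix_eq flip: matrix_vector_mul_assoc)
qed

text \<open>At the limit \<open>A0\<close> the matrix whose determinant
  \<open>rank_perturbation\<close> requires to be nonzero is the identity. The determinant therefore
  stays nonzero nearby and the rank cannot drop: rank is lower semicontinuous.\<close>

lemma eventually_rank_ge:
  fixes A :: "'x \<Rightarrow> real^'n^'m"
  assumes lim: "(A \<longlongrightarrow> A0) F"
  shows "\<forall>\<^sub>F z in F. rank A0 \<le> rank (A z)"
proof -
  obtain X where X: "A0 ** X ** A0 = A0" "X ** A0 ** X = X"
    by (rule matrix_generalized_inverse)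
  have "((\<lambda>z. A z ** X + (mat 1 - A0 ** X)) \<longlongrightarrow> A0 ** X + (mat 1 - A0 ** X)) F"
    by (intro tendsto_intros bounded_bilinear.tendsto[OF bounded_bilinear_matrix_matrix_mult] lim)
  then have "((\<lambda>z. det (A z ** X + (mat 1 - A0 ** X))) \<longlongrightarrow> 1) F"
    using tendsto_det by fastforce
  then have "\<forall>\<^sub>F z in F. det (A z ** X + (mat 1 - A0 ** X)) \<noteq> 0"
    by (rule tendsto_imp_eventually_ne) simp
  then show ?thesis
    by eventually_elim (use rank_perturbation(1)[OF X] rank_mul_le_left order_trans in blast)
qed

section \<open>Expansion of a multilinear matrix of bounded rank\<close>

text \<open>If \<open>G S\<close> is the mixed partial derivative over \<open>S\<close> of a matrix-valued function \<open>F\<close> that is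
  affine in each argument, \<open>implicit_coeff X Q G S\<close> is that of \<open>(F ** X + Q)\<^sup>-\<^sup>1 ** F\<close>: the recursion
  is the Leibniz rule for the product of \<open>F ** X + Q\<close> with the latter.\<close>

function implicit_coeff ::
  "real^'m^'n \<Rightarrow> real^'m^'m \<Rightarrow> (nat set \<Rightarrow> real^'n^'m) \<Rightarrow> nat set \<Rightarrow> real^'n^'m" where
  "implicit_coeff X Q G S = (if finite S then matrix_inv (G {} ** X + Q) **
     (G S - (\<Sum>R\<in>Pow S - {{}}. G R ** X ** implicit_coeff X Q G (S - R))) else 0)"
  by auto
termination
  by (relation "Wellfounded.measure (\<lambda>(X, Q, G, S). card S)") (auto intro!: psubset_card_mono)

declare implicit_coeff.simps [simp del]

lemma implicit_coeff_empty: "implicit_coeff X Q G {} = matrix_inv (G {} ** X + Q) ** G {}"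
  by (subst implicit_coeff.simps) simp

lemma sum_Pow_insert_nonempty:
  assumes "finite S" "i \<notin> S"
  shows "(\<Sum>R\<in>Pow (insert i S) - {{}}. f R)
    = f {i} + (\<Sum>R\<in>Pow S - {{}}. f R + f (insert i R))" (is "?l = ?r")
proof -
  have inj: "inj_on (insert i) (Pow S)"
    using assms(2) by (auto simp: inj_on_def)
  have "Pow (insert i S) - {{}} = (Pow S - {{}}) \<union> insert i ` Pow S"
    using assms(2) by (auto simp: Pow_insert)
  then have "?l = sum f (Pow S - {{}}) + sum f (insert i ` Pow S)"
    using assms by (auto intro!: sum.union_disjoint)
  also have "sum f (insert i ` Pow S) = (\<Sum>R\<in>Pow S. f (insert i R))"
    by (simp add: sum.reindex[OF inj])
  also have "\<dots> = f {i} + (\<Sum>R\<in>Pow S - {{}}. f (insert i R))"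
    using assms(1) by (subst sum.remove[of _ "{}"]) auto
  finally show ?thesis
    by (simp add: sum.distrib algebra_simps)
qed

text \<open>Differentiate the recursion, by induction on \<open>S\<close>. The subsets
  \<open>R\<close> of \<open>insert i S\<close> split according to whether \<open>i \<in> R\<close>;
  the product rule supplies both kinds, except \<open>R = {i}\<close>, which comes from
  differentiating the inverse.\<close>

lemma has_vector_derivative_implicit_coeff:
  fixes G :: "real \<Rightarrow> nat set \<Rightarrow> real^'n^'m"
  assumes aff: "\<And>z S. i \<notin> S \<Longrightarrow> G z S = G 0 S + z *\<^sub>R G 0 (insert i S)"
    and det: "det (G 0 {} ** X + Q) \<noteq> 0"
    and "finite S" "i \<notin> S"
  shows "((\<lambda>z. implicit_coeff X Q (G z) S) has_vector_derivative
    implicit_coeff X Q (G 0) (insert i S)) (at 0)"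
  using assms(3,4)
proof (induction S rule: finite_psubset_induct)
  case (psubset S)
  let ?W = "\<lambda>z. implicit_coeff X Q (G z)"
  define V where "V z = matrix_inv (G z {} ** X + Q)" for z
  define N where "N z = G z S - (\<Sum>R\<in>Pow S - {{}}. G z R ** X ** ?W z (S - R))" for z
  have W: "?W z S = V z ** N z" for z
    using psubset.hyps by (simp add: implicit_coeff.simps[of _ _ _ S] V_def N_def)
  have dG: "((\<lambda>z. G z R) has_vector_derivative G 0 (insert i R)) (at 0)" if "i \<notin> R" for R
  proof -
    have d: "((\<lambda>z. G 0 R + z *\<^sub>R G 0 (insert i R)) has_vector_derivative
        0 + (0 *\<^sub>R 0 + 1 *\<^sub>R G 0 (insert i R))) (at 0)"
      by (intro derivative_intros)
    have eq: "(\<lambda>z. G z R) = (\<lambda>z. G 0 R + z *\<^sub>R G 0 (insert i R))"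
      using aff[OF that] by (rule ext)
    show ?thesis
      by (subst eq) (use d in simp)
  qed
  have V: "V = (\<lambda>z. matrix_inv ((G 0 {} ** X + Q) + z *\<^sub>R (G 0 {i} ** X)))"
    unfolding V_def
    by (rule ext, subst aff) (auto simp: matrix_add_rdistrib matrix_mult_scaleR_left ac_simps)
  have dV: "(V has_vector_derivative - (V 0 ** (G 0 {i} ** X) ** V 0)) (at 0)"
    unfolding V using has_vector_derivative_matrix_inv[OF det, of "G 0 {i} ** X"] by simp
  define N' where "N' = G 0 (insert i S) - (\<Sum>R\<in>Pow S - {{}}.
      G 0 R ** X ** ?W 0 (insert i S - R) + G 0 (insert i R) ** X ** ?W 0 (S - R))"
  have "((\<lambda>z. G z R ** X ** ?W z (S - R)) has_vector_derivative
      G 0 R ** X ** ?W 0 (insert i S - R) + G 0 (insert i R) ** X ** ?W 0 (S - R)) (at 0)"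
    if R: "R \<in> Pow S - {{}}" for R
  proof -
    have "i \<notin> R" "S - R \<subset> S" "i \<notin> S - R"
      using R psubset.prems by auto
    then have "((\<lambda>z. G z R ** X) has_vector_derivative
        G 0 R ** 0 + G 0 (insert i R) ** X) (at 0)"
      by (intro has_vector_derivative_matrix_mult dG derivative_intros)
    moreover have "((\<lambda>z. ?W z (S - R)) has_vector_derivative ?W 0 (insert i S - R)) (at 0)"
      using psubset.IH[OF \<open>S - R \<subset> S\<close> \<open>i \<notin> S - R\<close>] \<open>i \<notin> R\<close> by (simp add: insert_Diff_if)
    ultimately show ?thesis
      by (auto dest: has_vector_derivative_matrix_mult)
  qed
  then have dN: "(N has_vector_derivative N') (at 0)"
    unfolding N_def[abs_def] N'_def
    by (intro derivative_intros dG psubset.prems)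
  have "?W 0 (insert i S) = V 0 ** (G 0 (insert i S) -
      (\<Sum>R\<in>Pow (insert i S) - {{}}. G 0 R ** X ** ?W 0 (insert i S - R)))"
    using psubset.hyps by (simp add: implicit_coeff.simps[of _ _ _ "insert i S"] V_def)
  also have "(\<Sum>R\<in>Pow (insert i S) - {{}}. G 0 R ** X ** ?W 0 (insert i S - R))
      = G 0 {i} ** X ** ?W 0 (insert i S - {i}) + (\<Sum>R\<in>Pow S - {{}}.
          G 0 R ** X ** ?W 0 (insert i S - R)
          + G 0 (insert i R) ** X ** ?W 0 (insert i S - insert i R))"
    by (rule sum_Pow_insert_nonempty[OF psubset.hyps psubset.prems])
  also have "(\<Sum>R\<in>Pow S - {{}}. G 0 R ** X ** ?W 0 (insert i S - R)
          + G 0 (insert i R) ** X ** ?W 0 (insert i S - insert i R))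
      = G 0 (insert i S) - N'"
    unfolding N'_def using psubset.prems by (auto intro!: sum.cong arg_cong[where f = "?W 0"])
  also have "insert i S - {i} = S"
    using psubset.prems by auto
  finally have "?W 0 (insert i S) = V 0 ** N' - V 0 ** (G 0 {i} ** X) ** V 0 ** N 0"
    by (simp add: W matrix_diff_ldistrib matrix_mul_assoc algebra_simps matrix_add_ldistrib)
  then show ?case
    using has_vector_derivative_matrix_mult[OF dV dN]
    by (simp add: W bounded_bilinear.minus_left[OF bounded_bilinear_matrix_matrix_mult])
qed

text \<open>For \<open>S = {}\<close> this is \<open>rank_perturbation\<close>. Each further index
  is a derivative along a line of base points, and the matrices fixed by the projection
  \<open>A0 ** X\<close> form a closed subspace, so difference quotients near \<open>a\<close> and
  their limit stay in it.\<close>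

lemma implicit_coeff_fixed_by_projection:
  fixes F :: "(nat \<Rightarrow> nat \<Rightarrow> real) \<Rightarrow> real^'n^'m" and X :: "real^'m^'n"
  assumes aff: "\<And>a i z. i < k \<Longrightarrow>
      F (a(i := \<lambda>x. a i x + z * b i x)) = F a + z *\<^sub>R F (a(i := b i))"
    and rank: "\<And>a. rank (F a) \<le> rank A0"
    and X: "A0 ** X ** A0 = A0" "X ** A0 ** X = X"
    and "finite S" "S \<subseteq> {..<k}" "det (F a ** X + (mat 1 - A0 ** X)) \<noteq> 0"
  defines "Q \<equiv> mat 1 - A0 ** X"
  shows "A0 ** X ** implicit_coeff X Q (\<lambda>S. F (override_on a b S)) S
    = implicit_coeff X Q (\<lambda>S. F (override_on a b S)) S"
  using assms(5-7)
proof (induction S arbitrary: a rule: finite_induct)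
  case empty
  then show ?case
    using rank_perturbation(2)[OF X empty(2) rank]
    by (simp add: implicit_coeff_empty Q_def)
next
  case (insert i S)
  \<comment> \<open>The induction hypothesis is applied at base points moved in direction
    \<open>b i\<close>, so \<open>a\<close> is kept arbitrary.\<close>
  define a' where "a' z = a(i := \<lambda>x. a i x + z * b i x)" for z
  define G where "G z S = F (override_on (a' z) b S)" for z S
  have a'0: "a' 0 = a"
    by (simp add: a'_def)
  have aff': "G z T = G 0 T + z *\<^sub>R G 0 (insert i T)" if "i \<notin> T" for z T
  proof -
    have "override_on (a' z) b T = (override_on a b T)(i := \<lambda>x. override_on a b T i x + z * b i x)"
      using that by (auto simp: a'_def override_on_def fun_eq_iff)
    then show ?thesis
      using insert.prems(1) unfolding G_def a'0 by (simp add: aff override_on_insert)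
  qed
  have Fa': "F (a' z) = F a + z *\<^sub>R G 0 {i}" for z
    using aff'[of "{}" z] by (simp add: G_def a'0)
  have "((\<lambda>z. F (a' z) ** X + Q) \<longlongrightarrow> (F a + 0 *\<^sub>R G 0 {i}) ** X + Q) (at 0)"
    unfolding Fa'
    by (intro tendsto_intros bounded_bilinear.tendsto[OF bounded_bilinear_matrix_matrix_mult])
  then have ev: "\<forall>\<^sub>F z in at 0. det (F (a' z) ** X + Q) \<noteq> 0"
    using insert.prems(2) by (intro tendsto_imp_eventually_ne[OF tendsto_det]) (auto simp: Q_def)
  let ?W = "\<lambda>z. implicit_coeff X Q (G z) S"
  have fixed: "A0 ** X ** ?W z = ?W z" if "det (F (a' z) ** X + Q) \<noteq> 0" for z
    using insert.IH[of "a' z"] insert.prems that by (simp add: G_def[abs_def] Q_def)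
  have fixed0: "A0 ** X ** ?W 0 = ?W 0"
    using fixed[of 0] insert.prems by (simp add: a'0 Q_def)
  have lim: "((\<lambda>z. inverse z *\<^sub>R (?W z - ?W 0)) \<longlongrightarrow> implicit_coeff X Q (G 0) (insert i S)) (at 0)"
  proof (rule has_vector_derivative_at_0_iff_tendsto[THEN iffD1],
      rule has_vector_derivative_implicit_coeff)
    show "det (G 0 {} ** X + Q) \<noteq> 0"
      using insert.prems by (simp add: G_def a'0 Q_def)
    show "G z T = G 0 T + z *\<^sub>R G 0 (insert i T)" if "i \<notin> T" for z T
      by (rule aff'[OF that])
  qed (use insert.hyps in auto)
  have "((\<lambda>z. A0 ** X ** (inverse z *\<^sub>R (?W z - ?W 0))) \<longlongrightarrow>
      A0 ** X ** implicit_coeff X Q (G 0) (insert i S)) (at 0)"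
    by (intro bounded_bilinear.tendsto[OF bounded_bilinear_matrix_matrix_mult] tendsto_const lim)
  moreover have "\<forall>\<^sub>F z in at 0. A0 ** X ** (inverse z *\<^sub>R (?W z - ?W 0)) = inverse z *\<^sub>R (?W z - ?W 0)"
    using ev by eventually_elim (simp add: matrix_mult_scaleR_right matrix_diff_ldistrib fixed fixed0)
  ultimately have "((\<lambda>z. inverse z *\<^sub>R (?W z - ?W 0)) \<longlongrightarrow>
      A0 ** X ** implicit_coeff X Q (G 0) (insert i S)) (at 0)"
    by (rule Lim_transform_eventually)
  then have "A0 ** X ** implicit_coeff X Q (G 0) (insert i S) = implicit_coeff X Q (G 0) (insert i S)"
    using lim tendsto_unique trivial_limit_at by blast
  then show ?case
    by (simp add: G_def[abs_def] a'0)
qed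

lemma matrix_inv_mat_1: "matrix_inv (mat 1 :: real^'n^'n) = mat 1"
  using matrix_inv_mult[of "mat 1 :: real^'n^'n"] by simp

text \<open>At \<open>a0\<close> the matrix to be inverted is the identity, so the recursion
  expresses \<open>G S\<close> as \<open>W S\<close> plus the summands with nonempty
  \<open>R\<close>. By the projection property \<open>W S = F a0 ** X ** W S\<close>, which is
  exactly the summand for \<open>R = {}\<close>.\<close>

lemma low_rank_expansion:
  fixes F :: "(nat \<Rightarrow> nat \<Rightarrow> real) \<Rightarrow> real^'n^'m" and X :: "real^'m^'n"
  assumes aff: "\<And>a i z. i < k \<Longrightarrow>
      F (a(i := \<lambda>x. a i x + z * b i x)) = F a + z *\<^sub>R F (a(i := b i))"
    and rank: "\<And>a. rank (F a) \<le> rank (F a0)"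
    and X: "F a0 ** X ** F a0 = F a0" "X ** F a0 ** X = X"
    and S: "S \<subseteq> {..<k}"
  defines "G \<equiv> \<lambda>S. F (override_on a0 b S)"
  shows "G S = (\<Sum>R\<in>Pow S. G R ** X ** implicit_coeff X (mat 1 - F a0 ** X) G (S - R))"
proof -
  define W where "W = implicit_coeff X (mat 1 - F a0 ** X) G"
  have fin: "finite S"
    using S finite_subset by blast
  have G0: "G {} = F a0"
    by (simp add: G_def)
  have "F a0 ** X ** W S = W S"
    unfolding W_def G_def
    by (rule implicit_coeff_fixed_by_projection[OF aff rank X fin S]) simp_all
  moreover have "W S = G S - (\<Sum>R\<in>Pow S - {{}}. G R ** X ** W (S - R))"
    unfolding W_def using fin by (subst implicit_coeff.simps) (simp add: G0 matrix_inv_mat_1)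
  moreover have "(\<Sum>R\<in>Pow S. G R ** X ** W (S - R))
      = G {} ** X ** W S + (\<Sum>R\<in>Pow S - {{}}. G R ** X ** W (S - R))"
    using fin by (subst sum.remove[of _ "{}"]) auto
  ultimately show ?thesis
    by (simp add: G0 W_def[symmetric])
qed

section \<open>Rank of sums of multilinear matrices\<close>

lemma sum_PiE_Un_disjoint:
  assumes "R \<inter> S = {}"
  shows "(\<Sum>j\<in>PiE (R \<union> S) A. f j) = (\<Sum>u\<in>PiE R A. \<Sum>v\<in>PiE S A. f (override_on v u R))"
proof -
  have "(\<Sum>j\<in>PiE (R \<union> S) A. f j) = (\<Sum>(u, v)\<in>PiE R A \<times> PiE S A. f (override_on v u R))"
    by (rule sum.reindex_bij_witness[where j = "\<lambda>j. (restrict j R, restrict j S)"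
          and i = "\<lambda>(u, v). override_on v u R"])
      (use assms in \<open>auto simp: override_on_def PiE_def extensional_def fun_eq_iff Pi_def restrict_def
        intro!: arg_cong[where f = f] ext split: if_splits\<close>)
  then show ?thesis
    by (simp add: sum.cartesian_product)
qed

text \<open>An explicit coordinate expansion rather than linearity in each argument: the index
  tuples are what the rank estimate counts, and independence of the arguments outside
  \<open>R\<close> is built in.\<close>

definition multilinear_in ::
  "nat set \<Rightarrow> (nat \<Rightarrow> nat) \<Rightarrow> ((nat \<Rightarrow> nat \<Rightarrow> real) \<Rightarrow> 'a::real_vector) \<Rightarrow> bool" where
  "multilinear_in R n f \<longleftrightarrow>
     (\<exists>c. \<forall>b. f b = (\<Sum>j\<in>PiE R (\<lambda>i. {..<n i}). (\<Prod>i\<in>R. b i (j i)) *\<^sub>R c j))"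

lemma multilinear_in_diff:
  assumes "multilinear_in R n f" "multilinear_in R n g"
  shows "multilinear_in R n (\<lambda>b. f b - g b)"
proof -
  obtain c c' where "\<And>b. f b = (\<Sum>j\<in>PiE R (\<lambda>i. {..<n i}). (\<Prod>i\<in>R. b i (j i)) *\<^sub>R c j)"
    "\<And>b. g b = (\<Sum>j\<in>PiE R (\<lambda>i. {..<n i}). (\<Prod>i\<in>R. b i (j i)) *\<^sub>R c' j)"
    using assms unfolding multilinear_in_def by blast
  then show ?thesis
    unfolding multilinear_in_def
    by (intro exI[of _ "\<lambda>j. c j - c' j"]) (simp add: scaleR_diff_right sum_subtractf)
qed

lemma multilinear_in_sum:
  assumes "\<And>i. i \<in> I \<Longrightarrow> multilinear_in R n (f i)"
  shows "multilinear_in R n (\<lambda>b. \<Sum>i\<in>I. f i b)"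
proof -
  obtain c where "\<And>i b. i \<in> I \<Longrightarrow>
      f i b = (\<Sum>j\<in>PiE R (\<lambda>i. {..<n i}). (\<Prod>l\<in>R. b l (j l)) *\<^sub>R c i j)"
    using assms unfolding multilinear_in_def by metis
  then have "(\<Sum>i\<in>I. f i b)
      = (\<Sum>j\<in>PiE R (\<lambda>i. {..<n i}). (\<Prod>l\<in>R. b l (j l)) *\<^sub>R (\<Sum>i\<in>I. c i j))" for b
    by (simp add: scaleR_sum_right sum.swap[of _ I])
  then show ?thesis
    unfolding multilinear_in_def by (intro exI[of _ "\<lambda>j. \<Sum>i\<in>I. c i j"]) simp
qed

lemma multilinear_in_bounded_linear:
  assumes "multilinear_in R n f" "bounded_linear h"
  shows "multilinear_in R n (\<lambda>b. h (f b))"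
proof -
  interpret bounded_linear h by fact
  obtain c where "\<And>b. f b = (\<Sum>j\<in>PiE R (\<lambda>i. {..<n i}). (\<Prod>i\<in>R. b i (j i)) *\<^sub>R c j)"
    using assms unfolding multilinear_in_def by blast
  then show ?thesis
    unfolding multilinear_in_def by (intro exI[of _ "\<lambda>j. h (c j)"]) (simp add: sum scaleR)
qed

lemma multilinear_in_mult:
  fixes f :: "_ \<Rightarrow> real^'n^'m" and g :: "_ \<Rightarrow> real^'p^'n"
  assumes f: "multilinear_in R n f" and g: "multilinear_in S n g"
    and RS: "R \<inter> S = {}" "finite R" "finite S"
  shows "multilinear_in (R \<union> S) n (\<lambda>b. f b ** g b)"
proof -
  let ?J = "\<lambda>R. PiE R (\<lambda>i. {..<n i})"
  obtain c where c: "\<And>b. f b = (\<Sum>j\<in>?J R. (\<Prod>i\<in>R. b i (j i)) *\<^sub>R c j)"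
    using f unfolding multilinear_in_def by blast
  obtain c' where c': "\<And>b. g b = (\<Sum>j\<in>?J S. (\<Prod>i\<in>S. b i (j i)) *\<^sub>R c' j)"
    using g unfolding multilinear_in_def by blast
  \<comment> \<open>As \<open>R\<close> and \<open>S\<close> are disjoint, a tuple on
    \<open>R \<union> S\<close> is a pair of tuples; its coefficient is the product of their
    coefficients.\<close>
  define e where "e j = c (restrict j R) ** c' (restrict j S)" for j
  have "f b ** g b = (\<Sum>j\<in>?J (R \<union> S). (\<Prod>i\<in>R \<union> S. b i (j i)) *\<^sub>R e j)" for b
  proof -
    have "(\<Prod>i\<in>R \<union> S. b i (override_on v u R i)) *\<^sub>R e (override_on v u R)
        = ((\<Prod>i\<in>R. b i (u i)) *\<^sub>R c u) ** ((\<Prod>i\<in>S. b i (v i)) *\<^sub>R c' v)"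
      if "u \<in> ?J R" "v \<in> ?J S" for u v
    proof -
      have "restrict (override_on v u R) R = u" "restrict (override_on v u R) S = v"
        using that RS(1) by (auto simp: override_on_def fun_eq_iff PiE_def extensional_def)
      moreover have "(\<Prod>i\<in>R \<union> S. b i (override_on v u R i))
          = (\<Prod>i\<in>R. b i (u i)) * (\<Prod>i\<in>S. b i (v i))"
        using RS by (subst prod.union_disjoint)
          (auto intro!: arg_cong2[where f = "(*)"] prod.cong simp: override_on_def)
      ultimately show ?thesis
        by (simp add: e_def matrix_mult_scaleR_left matrix_mult_scaleR_right)
    qed
    then show ?thesis
      unfolding sum_PiE_Un_disjoint[OF RS(1)] c c' matrix_mult_sum_left matrix_mult_sum_right
      by (subst sum.swap) (auto intro!: sum.cong)
  qed
  then show ?thesis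
    unfolding multilinear_in_def by blast
qed

lemma multilinear_in_override_on:
  assumes "multilinear_in K n f" "S \<subseteq> K" "finite K"
  shows "multilinear_in S n (\<lambda>b. f (override_on a b S))"
proof -
  let ?J = "\<lambda>R. PiE R (\<lambda>i. {..<n i})"
  obtain c where c: "\<And>b. f b = (\<Sum>j\<in>?J K. (\<Prod>i\<in>K. b i (j i)) *\<^sub>R c j)"
    using assms unfolding multilinear_in_def by blast
  have K: "S \<union> (K - S) = K" "S \<inter> (K - S) = {}"
    using assms(2) by auto
  \<comment> \<open>The arguments outside \<open>S\<close> are frozen at \<open>a\<close>, and their
    index tuples are summed into the coefficient.\<close>
  define e where "e u = (\<Sum>v\<in>?J (K - S). (\<Prod>i\<in>K - S. a i (v i)) *\<^sub>R c (override_on v u S))" for u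
  have "f (override_on a b S) = (\<Sum>u\<in>?J S. (\<Prod>i\<in>S. b i (u i)) *\<^sub>R e u)" for b
  proof -
    have "(\<Prod>i\<in>K. override_on a b S i (override_on v u S i))
        = (\<Prod>i\<in>S. b i (u i)) * (\<Prod>i\<in>K - S. a i (v i))" for u v
      using assms(2,3) by (subst K(1)[symmetric], subst prod.union_disjoint)
        (auto intro!: arg_cong2[where f = "(*)"] prod.cong simp: finite_subset)
    then show ?thesis
      unfolding c e_def
      using sum_PiE_Un_disjoint[OF K(2), where A = "\<lambda>i. {..<n i}"
          and f = "\<lambda>j. (\<Prod>i\<in>K. override_on a b S i (j i)) *\<^sub>R c j"]
      by (simp add: K(1)[simplified] scaleR_sum_right)
  qed
  then show ?thesis
    unfolding multilinear_in_def by blast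
qed

lemma multilinear_in_affine:
  assumes "multilinear_in K n f" "i \<in> K" "finite K"
  shows "f (a(i := \<lambda>x. a i x + z * b x)) = f a + z *\<^sub>R f (a(i := b))"
proof -
  obtain c where c: "\<And>b. f b = (\<Sum>j\<in>PiE K (\<lambda>i. {..<n i}). (\<Prod>i\<in>K. b i (j i)) *\<^sub>R c j)"
    using assms unfolding multilinear_in_def by blast
  have upd: "(\<Prod>l\<in>K. (a(i := u)) l (j l)) = u (j i) * (\<Prod>l\<in>K - {i}. a l (j l))" for u and j :: "nat \<Rightarrow> nat"
    using assms by (subst prod.remove[of _ i]) (auto intro!: prod.cong)
  have "(\<Prod>l\<in>K. a l (j l)) = a i (j i) * (\<Prod>l\<in>K - {i}. a l (j l))" for j
    using assms by (subst prod.remove[of _ i]) auto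
  then show ?thesis
    unfolding c upd by (simp add: scaleR_sum_right sum.distrib[symmetric] algebra_simps)
qed

text \<open>Induction along the recursion: each summand multiplies a factor multilinear over
  \<open>R\<close> by one multilinear over \<open>S - R\<close>, and the inverse in front depends on
  \<open>a\<close> but not on \<open>b\<close>.\<close>

lemma multilinear_in_implicit_coeff:
  fixes F :: "(nat \<Rightarrow> nat \<Rightarrow> real) \<Rightarrow> real^'n^'m"
  assumes F: "multilinear_in K n F" and K: "finite K" and "finite S" "S \<subseteq> K"
  shows "multilinear_in S n (\<lambda>b. implicit_coeff X Q (\<lambda>R. F (override_on a b R)) S)"
  using assms(3,4)
proof (induction S rule: finite_psubset_induct)
  case (psubset S)
  let ?W = "\<lambda>b. implicit_coeff X Q (\<lambda>R. F (override_on a b R))"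
  have "multilinear_in S n (\<lambda>b. F (override_on a b R) ** X ** ?W b (S - R))"
    if "R \<in> Pow S - {{}}" for R
  proof -
    have "S - R \<subset> S" "S - R \<subseteq> K" "R \<subseteq> K" "finite R"
      using that psubset by (auto simp: finite_subset)
    then have "multilinear_in (R \<union> (S - R)) n (\<lambda>b. F (override_on a b R) ** X ** ?W b (S - R))"
      using psubset.hyps
      by (intro multilinear_in_mult psubset.IH multilinear_in_override_on[OF F]
          multilinear_in_bounded_linear[where h = "\<lambda>Y. Y ** X"] K
          bounded_bilinear.bounded_linear_left[OF bounded_bilinear_matrix_matrix_mult]) auto
    moreover have "R \<union> (S - R) = S"
      using that by auto
    ultimately show ?thesis
      by simp
  qed
  then have "multilinear_in S n (\<lambda>b. matrix_inv (F a ** X + Q) **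
      (F (override_on a b S) - (\<Sum>R\<in>Pow S - {{}}. F (override_on a b R) ** X ** ?W b (S - R))))"
    using psubset.prems
    by (intro multilinear_in_bounded_linear[where h = "\<lambda>Y. matrix_inv (F a ** X + Q) ** Y"]
        multilinear_in_diff multilinear_in_sum multilinear_in_override_on[OF F] K
        bounded_bilinear.bounded_linear_right[OF bounded_bilinear_matrix_matrix_mult]) auto
  moreover have "?W b S = matrix_inv (F a ** X + Q) **
      (F (override_on a b S) - (\<Sum>R\<in>Pow S - {{}}. F (override_on a b R) ** X ** ?W b (S - R)))" for b
    using psubset.hyps by (subst implicit_coeff.simps) simp
  ultimately show ?case
    by simp
qed

text \<open>Expanding only \<open>f\<close> and collecting the rest over \<open>L\<close> leaves,
  for each index tuple \<open>j\<close> over \<open>R\<close>, one term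
  \<open>c j ** X ** ...\<close> of rank at most \<open>rank X\<close>, whatever the size of
  \<open>L\<close>. Expanding \<open>g\<close> instead gives the other bound.\<close>

lemma rank_sum_multilinear_le:
  fixes f :: "_ \<Rightarrow> real^'n^'m" and X :: "real^'p^'n" and g :: "_ \<Rightarrow> real^'q^'p"
  assumes f: "multilinear_in R n f" and g: "multilinear_in S n g"
    and fin: "finite R" "finite S"
  shows "rank (\<Sum>l\<in>L. f (b l) ** X ** g (b l)) \<le> min (\<Prod>i\<in>R. n i) (\<Prod>i\<in>S. n i) * rank X"
proof -
  let ?J = "\<lambda>R. PiE R (\<lambda>i. {..<n i})"
  obtain c where c: "\<And>b. f b = (\<Sum>j\<in>?J R. (\<Prod>i\<in>R. b i (j i)) *\<^sub>R c j)"
    using f unfolding multilinear_in_def by blast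
  obtain c' where c': "\<And>b. g b = (\<Sum>j\<in>?J S. (\<Prod>i\<in>S. b i (j i)) *\<^sub>R c' j)"
    using g unfolding multilinear_in_def by blast
  have rank_le: "rank (Y ** X ** Z) \<le> rank X" for Y :: "real^'n^'m" and Z :: "real^'q^'p"
    using rank_mul_le_left rank_mul_le_right order_trans by blast
  have "(\<Sum>l\<in>L. f (b l) ** X ** g (b l))
      = (\<Sum>j\<in>?J R. c j ** X ** (\<Sum>l\<in>L. (\<Prod>i\<in>R. b l i (j i)) *\<^sub>R g (b l)))"
    unfolding c
    by (simp add: matrix_mult_sum_left matrix_mult_sum_right matrix_mult_scaleR_left
        matrix_mult_scaleR_right sum.swap[of _ L])
  then have "rank (\<Sum>l\<in>L. f (b l) ** X ** g (b l)) \<le> (\<Sum>j\<in>?J R. rank X)"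
    by (simp only:) (rule rank_sum_le, rule rank_le)
  moreover have "(\<Sum>l\<in>L. f (b l) ** X ** g (b l))
      = (\<Sum>j\<in>?J S. (\<Sum>l\<in>L. (\<Prod>i\<in>S. b l i (j i)) *\<^sub>R f (b l)) ** X ** c' j)"
    unfolding c'
    by (simp add: matrix_mult_sum_left matrix_mult_sum_right matrix_mult_scaleR_left
        matrix_mult_scaleR_right sum.swap[of _ L])
  then have "rank (\<Sum>l\<in>L. f (b l) ** X ** g (b l)) \<le> (\<Sum>j\<in>?J S. rank X)"
    by (simp only:) (rule rank_sum_le, rule rank_le)
  ultimately show ?thesis
    using fin by (simp add: card_PiE min_def)
qed

theorem rank_sum_multilinear_matrices_le:
  fixes F :: "(nat \<Rightarrow> nat \<Rightarrow> real) \<Rightarrow> real^'n^'m"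
  assumes F: "multilinear_in {..<k} n F" and rank: "\<And>a. rank (F a) \<le> s"
  shows "rank (\<Sum>l\<in>L. F (b l)) \<le> 2 ^ k * n_star k n * s"
proof -
  \<comment> \<open>A maximum exists because all these ranks are bounded by
    \<open>s\<close>.\<close>
  obtain a0 where a0: "\<And>a. rank (F a) \<le> rank (F a0)"
    using ex_has_greatest_nat[of "\<lambda>_. True" _ "\<lambda>a. rank (F a)" "Suc s"] rank by (auto simp: less_Suc_eq_le)
  obtain X where X: "F a0 ** X ** F a0 = F a0" "X ** F a0 ** X = X" "rank X \<le> rank (F a0)"
    by (rule matrix_generalized_inverse)
  define G where "G b S = F (override_on a0 b S)" for b S
  define W where "W b = implicit_coeff X (mat 1 - F a0 ** X) (G b)" for b
  \<comment> \<open>\<open>override_on a0 b {..<k}\<close> agrees with \<open>b\<close> in all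
    arguments on which \<open>F\<close> depends.\<close>
  have "F b = G b {..<k}" for b
    using F unfolding multilinear_in_def G_def by (auto intro!: sum.cong)
  also have "G b {..<k} = (\<Sum>S\<in>Pow {..<k}. G b S ** X ** W b ({..<k} - S))" for b
    unfolding G_def W_def
    by (rule low_rank_expansion[where F = F and k = k, OF multilinear_in_affine[OF F] a0 X(1,2)]) auto
  finally have "(\<Sum>l\<in>L. F (b l))
      = (\<Sum>S\<in>Pow {..<k}. \<Sum>l\<in>L. G (b l) S ** X ** W (b l) ({..<k} - S))"
    by (simp add: sum.swap[of _ L])
  also have "rank \<dots> \<le> (\<Sum>S\<in>Pow {..<k}. n_star k n * rank X)"
  proof (rule rank_sum_le)
    fix S assume S: "S \<in> Pow {..<k}"
    have "rank (\<Sum>l\<in>L. G (b l) S ** X ** W (b l) ({..<k} - S))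
        \<le> min (\<Prod>i\<in>S. n i) (\<Prod>i\<in>{..<k} - S. n i) * rank X"
      unfolding G_def W_def
      using S by (intro rank_sum_multilinear_le[where f = "\<lambda>b. F (override_on a0 b S)"
            and g = "\<lambda>b. implicit_coeff X (mat 1 - F a0 ** X) (\<lambda>R. F (override_on a0 b R)) ({..<k} - S)"]
          multilinear_in_override_on[OF F] multilinear_in_implicit_coeff[OF F])
        (auto simp: finite_subset)
    also have "\<dots> \<le> n_star k n * rank X"
      unfolding n_star_def using S by (intro mult_right_mono Max_ge) auto
    finally show "rank (\<Sum>l\<in>L. G (b l) S ** X ** W (b l) ({..<k} - S)) \<le> n_star k n * rank X" .
  qed
  also have "\<dots> = 2 ^ k * n_star k n * rank X"
    by (simp add: card_Pow)
  also have "\<dots> \<le> 2 ^ k * n_star k n * s"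
    using X(3) rank[of a0] by (intro mult_left_mono) auto
  finally show ?thesis .
qed

section \<open>Evaluation of polynomials\<close>

abbreviation lookup where "lookup \<equiv> Poly_Mapping.lookup"
abbreviation keys where "keys \<equiv> Poly_Mapping.keys"

definition monomial_eval :: "('v \<Rightarrow> real) \<Rightarrow> ('v \<Rightarrow>\<^sub>0 nat) \<Rightarrow> real" where
  "monomial_eval x m = (\<Prod>v\<in>keys m. x v ^ lookup m v)"

lemma peval_eq_sum: "peval x p = (\<Sum>m\<in>keys p. lookup p m * monomial_eval x m)"
  by (simp add: peval_def monomial_eval_def)

lemma monomial_eval_eq_prod:
  assumes "finite V" "keys m \<subseteq> V"
  shows "monomial_eval x m = (\<Prod>v\<in>V. x v ^ lookup m v)"
  unfolding monomial_eval_def using assms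
  by (intro prod.mono_neutral_left) (auto simp: in_keys_iff)

lemma monomial_eval_add: "monomial_eval x (m + m') = monomial_eval x m * monomial_eval x m'"
proof -
  let ?V = "keys m \<union> keys m'"
  have "monomial_eval x l = (\<Prod>v\<in>?V. x v ^ lookup l v)" if "keys l \<subseteq> ?V" for l
    using that by (intro monomial_eval_eq_prod) auto
  then show ?thesis
    using Poly_Mapping.keys_add[of m m']
    by (simp add: lookup_add power_add prod.distrib)
qed

lemma peval_add: "peval x (p + q) = peval x p + peval x q"
  unfolding peval_eq_sum by (rule setsum_keys_plus_distrib) (auto simp: algebra_simps)

lemma peval_0 [simp]: "peval x 0 = 0"
  by (simp add: peval_def)

lemma peval_single: "peval x (Poly_Mapping.single m c) = c * monomial_eval x m"
  by (simp add: peval_eq_sum)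

lemma peval_sum: "peval x (\<Sum>i\<in>I. f i) = (\<Sum>i\<in>I. peval x (f i))"
  by (induction I rule: infinite_finite_induct) (auto simp: peval_add)

lemma poly_mapping_sum_singles: "p = (\<Sum>m\<in>keys p. Poly_Mapping.single m (lookup p m))"
proof (rule poly_mapping_eqI)
  fix m
  show "lookup p m = lookup (\<Sum>m\<in>keys p. Poly_Mapping.single m (lookup p m)) m"
    by (simp add: lookup_sum lookup_single when_def in_keys_iff)
qed

lemma peval_mult: "peval x (p * q) = peval x p * peval x q"
proof -
  have "p * q = (\<Sum>m\<in>keys p. \<Sum>m'\<in>keys q. Poly_Mapping.single (m + m') (lookup p m * lookup q m'))"
    by (subst poly_mapping_sum_singles[of p], subst poly_mapping_sum_singles[of q])
      (simp add: sum_product mult_single)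
  then show ?thesis
    by (simp add: peval_sum peval_single monomial_eval_add)
      (simp add: peval_eq_sum sum_product mult_ac)
qed

lemma peval_1 [simp]: "peval x 1 = 1"
  using peval_single[of x 0 1] by (simp add: monomial_eval_def)

lemma peval_power: "peval x (p ^ e) = peval x p ^ e"
  by (induction e) (auto simp: peval_mult)

lemma peval_prod: "peval x (\<Prod>i\<in>I. f i) = (\<Prod>i\<in>I. peval x (f i))"
  by (induction I rule: infinite_finite_induct) (auto simp: peval_mult)

lemma peval_Const [simp]: "peval x (Const c) = c"
  by (simp add: Const_def peval_single monomial_eval_def)

lemma peval_Var [simp]: "peval x (Var v) = x v"
  by (simp add: Var_def peval_single monomial_eval_def)

lemma peval_psubst: "peval x (psubst \<sigma> p) = peval (\<lambda>v. peval x (\<sigma> v)) p"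
  unfolding psubst_def peval_def[of "\<lambda>v. peval x (\<sigma> v)"]
  by (simp add: peval_sum peval_mult peval_prod peval_power)

lemma peval_cong:
  assumes "\<And>v. v \<in> vars p \<Longrightarrow> x v = y v"
  shows "peval x p = peval y p"
  unfolding peval_def
  by (intro sum.cong refl arg_cong2[where f = "(*)"] prod.cong arg_cong2[where f = "(^)"] assms)
    (auto simp: vars_def)

section \<open>Limits, restriction to lines and nonvanishing\<close>

lemma tendsto_peval:
  assumes "\<And>v. ((\<lambda>t. x t v) \<longlongrightarrow> y v) F"
  shows "((\<lambda>t. peval (x t) p) \<longlongrightarrow> peval y p) F"
  unfolding peval_def by (intro tendsto_intros assms)

lemma peval_on_line:
  obtains Q :: "real poly" where "\<And>t. poly Q t = peval (\<lambda>v. x v + t * y v) p"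
proof
  fix t
  show "poly (\<Sum>m\<in>keys p. smult (lookup p m) (\<Prod>v\<in>keys m. [:x v, y v:] ^ lookup m v)) t
    = peval (\<lambda>v. x v + t * y v) p"
    by (simp add: peval_def poly_sum poly_prod poly_power)
qed

text \<open>Induction on the variables. As a polynomial in the value \<open>w\<close> of one
  variable \<open>v\<close>, the sum has vanishing coefficients; each coefficient is a sum of the
  same kind over those \<open>m\<close> with a fixed exponent at \<open>v\<close>, which is why
  \<open>K\<close> varies in the induction.\<close>

lemma power_products_independent:
  fixes e :: "'k \<Rightarrow> 'v \<Rightarrow> nat" and c :: "'k \<Rightarrow> real"
  assumes "finite V" "finite K"
    and "\<And>m m'. m \<in> K \<Longrightarrow> m' \<in> K \<Longrightarrow> (\<And>v. v \<in> V \<Longrightarrow> e m v = e m' v) \<Longrightarrow> m = m'"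
    and "\<And>x. (\<Sum>m\<in>K. c m * (\<Prod>v\<in>V. x v ^ e m v)) = 0"
    and "m \<in> K"
  shows "c m = 0"
  using assms
proof (induction V arbitrary: K m rule: finite_induct)
  case empty
  then have "K = {m}"
    by blast
  then show ?case
    using empty.prems(3) by simp
next
  case (insert v V)
  define N where "N = Max ((\<lambda>m. e m v) ` K)"
  have N: "e m v \<le> N" if "m \<in> K" for m
    unfolding N_def using that insert.prems(1) by (intro Max_ge) auto
  let ?K = "\<lambda>i. {m \<in> K. e m v = i}"
  have zero: "(\<Sum>m\<in>?K i. c m * (\<Prod>u\<in>V. x u ^ e m u)) = 0" if "i \<le> N" for i x
  proof (rule zero_polynom_imp_zero_coeffs[OF _ that])
    fix w :: real
    have "(\<Prod>u\<in>insert v V. (x(v := w)) u ^ e m u) = (\<Prod>u\<in>V. x u ^ e m u) * w ^ e m v" for m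
    proof -
      have "(\<Prod>u\<in>V. (x(v := w)) u ^ e m u) = (\<Prod>u\<in>V. x u ^ e m u)"
        using insert.hyps by (intro prod.cong) auto
      then show ?thesis
        using insert.hyps by simp
    qed
    then have "0 = (\<Sum>m\<in>K. c m * (\<Prod>u\<in>V. x u ^ e m u) * w ^ e m v)"
      using insert.prems(3)[of "x(v := w)"] by (simp add: mult.assoc)
    also have "\<dots> = (\<Sum>i\<le>N. \<Sum>m\<in>?K i. c m * (\<Prod>u\<in>V. x u ^ e m u) * w ^ e m v)"
      using insert.prems(1) N by (intro sum.group[symmetric]) auto
    also have "\<dots> = (\<Sum>i\<le>N. (\<Sum>m\<in>?K i. c m * (\<Prod>u\<in>V. x u ^ e m u)) * w ^ i)"
      by (auto simp: sum_distrib_right intro!: sum.cong)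
    finally show "(\<Sum>i\<le>N. (\<Sum>m\<in>?K i. c m * (\<Prod>u\<in>V. x u ^ e m u)) * w ^ i) = 0"
      by simp
  qed
  show ?case
  proof (rule insert.IH[of "?K (e m v)"])
    show "m1 = m2" if "m1 \<in> ?K (e m v)" "m2 \<in> ?K (e m v)" "\<And>u. u \<in> V \<Longrightarrow> e m1 u = e m2 u" for m1 m2
      using that by (intro insert.prems(2)) auto
  qed (use insert.prems zero N in auto)
qed

lemma peval_nonzero:
  assumes "p \<noteq> 0"
  obtains x where "peval x p \<noteq> 0"
proof (rule ccontr)
  assume "\<not> thesis"
  then have zero: "peval x p = 0" for x
    using that by blast
  have fin: "finite (vars p)"
    by (simp add: vars_def)
  have sub: "keys m \<subseteq> vars p" if "m \<in> keys p" for m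
    using that by (auto simp: vars_def)
  have "lookup p m = 0" if "m \<in> keys p" for m
  proof (rule power_products_independent[OF fin, of "keys p" lookup])
    show "m1 = m2" if "m1 \<in> keys p" "m2 \<in> keys p" "\<And>v. v \<in> vars p \<Longrightarrow> lookup m1 v = lookup m2 v"
      for m1 m2
    proof (rule poly_mapping_eqI)
      show "lookup m1 v = lookup m2 v" for v
      proof (cases "v \<in> vars p")
        case False
        then have "v \<notin> keys m1" "v \<notin> keys m2"
          using that(1,2) sub by blast+
        then show ?thesis
          by (simp add: in_keys_iff)
      qed (use that in auto)
    qed
    show "(\<Sum>m\<in>keys p. lookup p m * (\<Prod>v\<in>vars p. x v ^ lookup m v)) = 0" for x
      using zero[of x] by (simp add: peval_eq_sum monomial_eval_eq_prod[OF fin sub])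
  qed (use that in auto)
  then have "lookup p m = 0" for m
    by (cases "m \<in> keys p") (auto simp: in_keys_iff)
  then show False
    using assms by (metis poly_mapping_eqI lookup_zero)
qed

section \<open>Inclusion-exclusion over the set of tensors\<close>

lemma homogeneous_peval:
  assumes "homogeneous d p"
  shows "peval (\<lambda>v. c * x v) p = c ^ d * peval x p"
proof -
  have "monomial_eval (\<lambda>v. c * x v) m = c ^ d * monomial_eval x m" if "m \<in> keys p" for m
    using assms that
    by (simp add: monomial_eval_def power_mult_distrib prod.distrib homogeneous_def flip: power_sum)
  then show ?thesis
    by (simp add: peval_eq_sum sum_distrib_left mult_ac)
qed

text \<open>The sum expands a product over \<open>D\<close> whose factor at \<open>x\<close> is
  \<open>-1\<close> for \<open>x \<in> K\<close> and \<open>0\<close> otherwise.\<close>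

lemma alternating_sum_supersets:
  assumes "finite D" "K \<subseteq> D"
  shows "(\<Sum>A\<in>Pow D. if K \<subseteq> A then (-1) ^ card A else 0) = (if K = D then (-1) ^ card D else (0::real))"
proof -
  have "(\<Sum>A\<in>Pow D. if K \<subseteq> A then (-1) ^ card A else 0)
      = (\<Sum>A\<in>Pow D. (-1) ^ card A * (\<Prod>x\<in>A. 1) * (\<Prod>x\<in>D - A. if x \<in> K then 0 else (1::real)))"
  proof (intro sum.cong refl)
    fix A assume "A \<in> Pow D"
    then have "(\<Prod>x\<in>D - A. if x \<in> K then 0 else (1::real)) = (if K \<subseteq> A then 1 else 0)"
      using assms by (auto intro!: prod.neutral)
    then show "(if K \<subseteq> A then (-1) ^ card A else 0)
        = (-1) ^ card A * (\<Prod>x\<in>A. 1) * (\<Prod>x\<in>D - A. if x \<in> K then 0 else (1::real))"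
      by simp
  qed
  also have "\<dots> = (\<Prod>x\<in>D. (if x \<in> K then 0 else 1) - 1)"
    using assms(1) by (rule prod_diff_conv_sum[symmetric])
  also have "\<dots> = (if K = D then (-1) ^ card D else 0)"
    using assms by (auto simp: prod_zero_iff)
  finally show ?thesis .
qed

text \<open>\<open>card A ^ d\<close> counts the maps from \<open>{..<d}\<close> into
  \<open>A\<close>. By inclusion-exclusion only the surjections onto \<open>{..<d}\<close> survive,
  all with the sign \<open>(-1) ^ d\<close>, and the identity is one of them.\<close>

lemma alternating_sum_card_power_nonzero:
  "(\<Sum>A\<in>Pow {..<d}. (-1) ^ card A * real (card A) ^ d) \<noteq> 0"
proof -
  let ?D = "{..<d}"
  have "real (card A) ^ d = (\<Sum>f\<in>?D \<rightarrow>\<^sub>E ?D. if f ` ?D \<subseteq> A then 1 else 0)" if "A \<subseteq> ?D" for A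
  proof -
    have "{f \<in> ?D \<rightarrow>\<^sub>E ?D. f ` ?D \<subseteq> A} = ?D \<rightarrow>\<^sub>E A"
      using that by (auto simp: PiE_def Pi_def image_subset_iff)
    then show ?thesis
      by (simp add: sum.If_cases card_PiE Int_def finite_PiE)
  qed
  then have "(\<Sum>A\<in>Pow ?D. (-1) ^ card A * real (card A) ^ d)
      = (\<Sum>A\<in>Pow ?D. \<Sum>f\<in>?D \<rightarrow>\<^sub>E ?D. if f ` ?D \<subseteq> A then (-1) ^ card A else 0)"
    by (auto simp: sum_distrib_left intro!: sum.cong)
  also have "\<dots> = (\<Sum>f\<in>?D \<rightarrow>\<^sub>E ?D. if f ` ?D = ?D then (-1) ^ d else 0)"
    by (subst sum.swap, intro sum.cong refl, subst alternating_sum_supersets) auto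
  also have "\<dots> = (-1) ^ d * real (card {f \<in> ?D \<rightarrow>\<^sub>E ?D. f ` ?D = ?D})"
    by (simp add: sum.If_cases Int_def finite_PiE)
  also have "\<dots> \<noteq> 0"
  proof -
    have "restrict id ?D \<in> {f \<in> ?D \<rightarrow>\<^sub>E ?D. f ` ?D = ?D}"
      by auto
    moreover have "finite {f \<in> ?D \<rightarrow>\<^sub>E ?D. f ` ?D = ?D}"
      by (simp add: finite_PiE)
    ultimately have "card {f \<in> ?D \<rightarrow>\<^sub>E ?D. f ` ?D = ?D} \<noteq> 0"
      unfolding card_eq_0_iff by blast
    then show ?thesis
      by simp
  qed
  finally show ?thesis .
qed

text \<open>Plugging \<open>T\<^sub>l = x\<close> for \<open>l \<in> A\<close> and \<open>T\<^sub>l = 0\<close> otherwise, the alternating sum over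
  \<open>A \<subseteq> {..<d}\<close> kills every monomial missing one of the tensors, but multiplies \<open>p(x)\<close> by \<open>\<plusminus>d!\<close>.\<close>

lemma expand_sum_involves_fewer_tensors_imp_0:
  assumes hom: "homogeneous d p" and dr: "d \<le> r"
    and fewer: "involves_fewer_tensors d r J (expand_sum r p)"
  shows "p = 0"
proof (rule ccontr)
  assume "p \<noteq> 0"
  then obtain x where x: "peval x p \<noteq> 0"
    by (rule peval_nonzero)
  define q where "q = expand_sum r p"
  define y where "y A = (\<lambda>(l, j). if l \<in> A then x j else 0)" for A :: "nat set"
  \<comment> \<open>The sum of the \<open>r\<close> tensors becomes \<open>card A\<close> times
    \<open>x\<close>, and homogeneity pulls out \<open>real (card A) ^ d\<close>.\<close>
  have "peval (y A) q = real (card A) ^ d * peval x p" if "A \<subseteq> {..<d}" for A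
  proof -
    have "A \<subseteq> {..<r}"
      using that dr by auto
    then have "{..<r} \<inter> A = A"
      by auto
    then have "(\<Sum>l<r. peval (y A) (Var (l, j))) = real (card A) * x j" for j
      by (simp add: y_def sum.If_cases)
    then show ?thesis
      by (simp add: q_def expand_sum_def peval_psubst peval_sum homogeneous_peval[OF hom])
  qed
  then have "(\<Sum>A\<in>Pow {..<d}. (-1) ^ card A * real (card A) ^ d) * peval x p
      = (\<Sum>A\<in>Pow {..<d}. (-1) ^ card A * peval (y A) q)"
    by (auto simp: sum_distrib_right intro!: sum.cong)
  also have "\<dots> = (\<Sum>m\<in>keys q. lookup q m * (\<Sum>A\<in>Pow {..<d}. (-1) ^ card A * monomial_eval (y A) m))"
    unfolding peval_eq_sum sum_distrib_left by (subst sum.swap) (simp add: mult.left_commute)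
  also have "\<dots> = 0"
  proof (intro sum.neutral ballI)
    fix m assume m: "m \<in> keys q"
    let ?K = "fst ` keys m"
    have eval: "monomial_eval (y A) m = (if ?K \<subseteq> A then monomial_eval (x \<circ> snd) m else 0)" for A
    proof (cases "?K \<subseteq> A")
      case True
      then show ?thesis
        by (auto simp: monomial_eval_def y_def split_beta intro!: prod.cong)
    next
      case False
      then obtain v where "v \<in> keys m" "fst v \<notin> A"
        by auto
      then show ?thesis
        using False by (auto simp: monomial_eval_def y_def split_beta in_keys_iff intro!: bexI[of _ v])
    qed
    \<comment> \<open>If the tensors of the monomial lie in \<open>{..<d}\<close>, one is missing
      since there are fewer than \<open>d\<close> of them; otherwise no \<open>A\<close> contains
      them all.\<close>
    have "(\<Sum>A\<in>Pow {..<d}. if ?K \<subseteq> A then (-1) ^ card A else (0::real)) = 0"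
    proof (cases "?K \<subseteq> {..<d}")
      case True
      have "card ?K < d"
        using fewer m by (simp add: involves_fewer_tensors_def q_def)
      then have "?K \<noteq> {..<d}"
        by auto
      then show ?thesis
        using alternating_sum_supersets[OF _ True] by simp
    next
      case False
      then show ?thesis
        by (intro sum.neutral) auto
    qed
    moreover have "(\<Sum>A\<in>Pow {..<d}. (-1) ^ card A * monomial_eval (y A) m)
        = (\<Sum>A\<in>Pow {..<d}. if ?K \<subseteq> A then (-1) ^ card A else 0) * monomial_eval (x \<circ> snd) m"
      unfolding eval sum_distrib_right by (intro sum.cong) auto
    ultimately show "lookup q m * (\<Sum>A\<in>Pow {..<d}. (-1) ^ card A * monomial_eval (y A) m) = 0"
      by simp
  qed
  finally show False
    using x alternating_sum_card_power_nonzero[of d] by simp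
qed

section \<open>Multihomogeneous polynomials at rank-one tensors\<close>

lemma finite_multi_indices: "finite (multi_indices k n)"
  by (simp add: multi_indices_def finite_PiE)

text \<open>Unit vectors as components give an elementary tensor. Multi-indices are extensional, so
  two different ones differ at some \<open>i < k\<close>.\<close>

lemma rank_one_tensor_standard_basis:
  assumes "j \<in> multi_indices k n" "u \<in> multi_indices k n"
  shows "rank_one_tensor k (\<lambda>i x. if x = u i then 1 else 0) j = (if j = u then 1 else 0)"
proof (cases "j = u")
  case False
  then obtain i where "i < k" "j i \<noteq> u i"
    using assms PiE_ext[of j "{..<k}" "\<lambda>i. {..<n i}" u] by (auto simp: multi_indices_def)
  then show ?thesis
    using False by (auto simp: rank_one_tensor_def intro!: bexI[of _ i])
qed (simp add: rank_one_tensor_def)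

text \<open>Natural numbers with sum 1 are all 0 except for a single 1.\<close>

lemma multi_homogeneous_1_unique_index:
  assumes "multi_homogeneous_1 d J p" "finite J" "m \<in> keys p" "s < d"
  obtains u where "u \<in> J" "lookup m (s, u) = 1" "\<And>j. j \<noteq> u \<Longrightarrow> lookup m (s, j) = 0"
proof -
  have "(\<Sum>j\<in>J. lookup m (s, j)) = 1"
    using assms by (simp add: multi_homogeneous_1_def)
  then obtain u where u: "u \<in> J" "lookup m (s, u) = 1" "\<And>j. j \<in> J \<Longrightarrow> j \<noteq> u \<Longrightarrow> lookup m (s, j) = 0"
    using sum_eq_1_iff[OF assms(2), of "\<lambda>j. lookup m (s, j)"] by metis
  have "keys m \<subseteq> {..<d} \<times> J"
    using assms(1,3) unfolding multi_homogeneous_1_def vars_def by blast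
  then have "lookup m (s, j) = 0" if "j \<notin> J" for j
    using that by (metis in_keys_iff mem_Sigma_iff subsetD)
  then show ?thesis
    using that u by metis
qed

text \<open>A monomial picks exactly one entry of each of the \<open>d\<close> tensors. Taking for
  each \<open>s\<close> the elementary tensor at the entry picked by \<open>m0\<close> makes
  \<open>m0\<close> evaluate to 1 and every other monomial of \<open>p\<close> to 0, which isolates
  the coefficient of \<open>m0\<close>.\<close>

lemma multi_homogeneous_1_nonzero_at_rank_one:
  assumes hom: "multi_homogeneous_1 d (multi_indices k n) p" and "p \<noteq> 0"
  obtains a where "peval (\<lambda>(s, j). rank_one_tensor k (a s) j) p \<noteq> 0"
proof -
  let ?J = "multi_indices k n"
  note unique = multi_homogeneous_1_unique_index[OF hom finite_multi_indices]
  obtain m0 where m0: "m0 \<in> keys p"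
    using \<open>p \<noteq> 0\<close> by (meson all_not_in_conv keys_eq_empty)
  have "\<exists>u. u \<in> ?J \<and> lookup m0 (s, u) = 1 \<and> (\<forall>j. j \<noteq> u \<longrightarrow> lookup m0 (s, j) = 0)" if "s < d" for s
    using unique[OF m0 that] by metis
  then obtain u where u: "\<And>s. s < d \<Longrightarrow> u s \<in> ?J" "\<And>s. s < d \<Longrightarrow> lookup m0 (s, u s) = 1"
    "\<And>s j. s < d \<Longrightarrow> j \<noteq> u s \<Longrightarrow> lookup m0 (s, j) = 0"
    by metis
  define y where "y = (\<lambda>(s, j). rank_one_tensor k (\<lambda>i x. if x = u s i then 1 else 0) j)"
  have keys: "fst v < d \<and> snd v \<in> ?J" if "m \<in> keys p" "v \<in> keys m" for m v
    using hom that by (fastforce simp: multi_homogeneous_1_def vars_def)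
  have y: "y v = (if snd v = u (fst v) then 1 else 0)" if "m \<in> keys p" "v \<in> keys m" for m v
    using rank_one_tensor_standard_basis[of "snd v" k n "u (fst v)"] keys[OF that] u(1)
    by (simp add: y_def split_beta)
  have "monomial_eval y m = (if m = m0 then 1 else 0)" if m: "m \<in> keys p" for m
  proof (cases "\<forall>v\<in>keys m. snd v = u (fst v)")
    case True
    have "lookup m (s, j) = lookup m0 (s, j)" for s j
    proof (cases "s < d")
      case s: True
      obtain u' where u': "lookup m (s, u') = 1" "\<And>j. j \<noteq> u' \<Longrightarrow> lookup m (s, j) = 0"
        using unique[OF m s] by metis
      then have "(s, u') \<in> keys m"
        by (simp add: in_keys_iff)
      then have "u' = u s"
        using True by fastforce
      then show ?thesis
        using u' u[OF s] by (cases "j = u s") auto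
    next
      case False
      then have "(s, j) \<notin> keys m" "(s, j) \<notin> keys m0"
        using keys[OF m, of "(s, j)"] keys[OF m0, of "(s, j)"] by auto
      then show ?thesis
        by (simp add: in_keys_iff)
    qed
    then have "m = m0"
      by (intro poly_mapping_eqI) auto
    then show ?thesis
      using True y[OF m] by (simp add: monomial_eval_def)
  next
    case False
    then obtain v where v: "v \<in> keys m" "snd v \<noteq> u (fst v)"
      by auto
    then have "m \<noteq> m0"
      using u(3)[of "fst v" "snd v"] keys[OF m v(1)] by (auto simp: in_keys_iff)
    then show ?thesis
      using v y[OF m] by (auto simp: monomial_eval_def in_keys_iff intro!: bexI[of _ v])
  qed
  then have "peval y p = lookup p m0"
    using m0 by (simp add: peval_eq_sum if_distrib[of "(*) _"] cong: if_cong)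
  then have "peval y p \<noteq> 0"
    using m0 by (simp add: in_keys_iff)
  then show ?thesis
    using that[of "\<lambda>s i x. if x = u s i then 1 else 0"] unfolding y_def by simp
qed

text \<open>Each monomial contains exactly one variable of tensor \<open>e\<close>, to the first
  power; its remaining factors do not depend on \<open>t\<close>.\<close>

lemma multi_homogeneous_1_linear:
  assumes hom: "multi_homogeneous_1 d J p" and J: "finite J" and "e < d"
  obtains c where "\<And>t. peval (\<lambda>(s, j). if s = e then t j else y (s, j)) p = (\<Sum>j\<in>J. t j * c j)"
proof -
  have "\<exists>u. u \<in> J \<and> lookup m (e, u) = 1 \<and> (\<forall>j. j \<noteq> u \<longrightarrow> lookup m (e, j) = 0)"
    if "m \<in> keys p" for m
    using multi_homogeneous_1_unique_index[OF hom J that \<open>e < d\<close>] by metis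
  then obtain u where u: "\<And>m. m \<in> keys p \<Longrightarrow> u m \<in> J" "\<And>m. m \<in> keys p \<Longrightarrow> lookup m (e, u m) = 1"
    "\<And>m j. m \<in> keys p \<Longrightarrow> j \<noteq> u m \<Longrightarrow> lookup m (e, j) = 0"
    by metis
  define w where "w m = lookup p m * (\<Prod>v\<in>keys m - {(e, u m)}. y v ^ lookup m v)" for m
  show ?thesis
  proof
    fix t
    let ?y = "\<lambda>(s, j). if s = e then t j else y (s, j)"
    have "lookup p m * monomial_eval ?y m = t (u m) * w m" if m: "m \<in> keys p" for m
    proof -
      have "(e, u m) \<in> keys m"
        using u(2)[OF m] by (simp add: in_keys_iff)
      then have "monomial_eval ?y m = t (u m) * (\<Prod>v\<in>keys m - {(e, u m)}. ?y v ^ lookup m v)"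
        unfolding monomial_eval_def by (subst prod.remove[of _ "(e, u m)"]) (auto simp: u(2)[OF m])
      also have "(\<Prod>v\<in>keys m - {(e, u m)}. ?y v ^ lookup m v)
          = (\<Prod>v\<in>keys m - {(e, u m)}. y v ^ lookup m v)"
      proof (intro prod.cong refl)
        fix v assume v: "v \<in> keys m - {(e, u m)}"
        then have "fst v \<noteq> e"
          using u(3)[OF m, of "snd v"] by (cases v) (auto simp: in_keys_iff)
        then show "?y v ^ lookup m v = y v ^ lookup m v"
          by (simp add: split_beta)
      qed
      finally show ?thesis
        by (simp add: w_def)
    qed
    then have "peval ?y p = (\<Sum>m\<in>keys p. t (u m) * w m)"
      by (simp add: peval_eq_sum)
    also have "\<dots> = (\<Sum>m\<in>keys p. \<Sum>j\<in>J. if u m = j then t j * w m else 0)"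
      using u(1) J by (intro sum.cong) auto
    also have "\<dots> = (\<Sum>j\<in>J. t j * (\<Sum>m\<in>keys p. if u m = j then w m else 0))"
      by (subst sum.swap) (auto simp: sum_distrib_left intro!: sum.cong)
    finally show "peval ?y p = (\<Sum>j\<in>J. t j * (\<Sum>m\<in>keys p. if u m = j then w m else 0))" .
  qed
qed

section \<open>The bound on the number of summands\<close>

text \<open>An increasing tuple is recovered from its image as the sorted list of its elements, so
  the tuples inject into the \<open>d\<close>-subsets.\<close>

lemma card_increasing_tuples_le: "card (increasing_tuples d r) \<le> r choose d"
proof -
  have sorted_map: "sorted (map l [0..<d])" "distinct (map l [0..<d])"
    if "l \<in> increasing_tuples d r" for l
  proof -
    have mono: "strict_mono_on {..<d} l"
      using that by (simp add: increasing_tuples_def)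
    show "sorted (map l [0..<d])"
      using mono by (auto simp: sorted_iff_nth_mono strict_mono_on_leD)
    show "distinct (map l [0..<d])"
      using strict_mono_on_imp_inj_on[OF mono] by (simp add: distinct_map atLeast0LessThan)
  qed
  have "inj_on (\<lambda>l. l ` {..<d}) (increasing_tuples d r)"
  proof (rule inj_onI)
    fix l l' assume l: "l \<in> increasing_tuples d r" "l' \<in> increasing_tuples d r"
      and "l ` {..<d} = l' ` {..<d}"
    then have "map l [0..<d] = map l' [0..<d]"
      by (intro sorted_distinct_set_unique sorted_map) (auto simp: atLeast0LessThan)
    then show "l = l'"
      using l by (intro PiE_ext[of l "{..<d}" "\<lambda>_. {..<r}" l']) (auto simp: increasing_tuples_def)
  qed
  moreover have "(\<lambda>l. l ` {..<d}) ` increasing_tuples d r \<subseteq> {A. A \<subseteq> {..<r} \<and> card A = d}"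
    by (auto simp: increasing_tuples_def PiE_def Pi_def card_image strict_mono_on_imp_inj_on)
  ultimately have "card (increasing_tuples d r) \<le> card {A. A \<subseteq> {..<r} \<and> card A = d}"
    by (intro card_inj_on_le) auto
  then show ?thesis
    by (simp add: n_subsets)
qed

lemma finite_increasing_tuples: "finite (increasing_tuples d r)"
  unfolding increasing_tuples_def by (rule finite_subset[of _ "{..<d} \<rightarrow>\<^sub>E {..<r}"]) (auto simp: finite_PiE)

text \<open>The summands outside \<open>I'\<close> add at most \<open>s\<close> each to the rank, so
  a full sum of rank at least \<open>card I * s\<close> leaves at least \<open>card I' * s\<close>
  for those inside.\<close>

lemma rank_subsum_ge:
  fixes A :: "'i \<Rightarrow> real^'n^'m"
  assumes "finite I" "I' \<subseteq> I" "\<And>i. i \<in> I \<Longrightarrow> rank (A i) \<le> s" "card I * s \<le> rank (sum A I)"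
  shows "card I' * s \<le> rank (sum A I')"
proof -
  have "sum A I = sum A I' + sum A (I - I')"
    using assms(1,2) by (metis add.commute sum.subset_diff)
  then have "card I * s \<le> rank (sum A I') + rank (sum A (I - I'))"
    using assms(4) rank_add_le order_trans by metis
  moreover have "rank (sum A (I - I')) \<le> (\<Sum>i\<in>I - I'. s)"
    using assms(3) by (intro rank_sum_le) auto
  moreover have "card I = card I' + card (I - I')"
    using assms(1,2) by (simp add: card_Diff_subset card_mono finite_subset)
  ultimately show ?thesis
    by (simp add: add_mult_distrib)
qed

lemma n_star_ge_1:
  assumes "multi_indices k n \<noteq> {}"
  shows "n_star k n \<ge> 1"
proof -
  obtain j where "j \<in> multi_indices k n"
    using assms by auto
  then have pos: "n i \<noteq> 0" if "i < k" for i
    using that PiE_mem[of j "{..<k}" "\<lambda>i. {..<n i}" i] by (auto simp: multi_indices_def)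
  have "(\<Prod>i<k. n i) \<ge> 1"
    using pos by (intro prod_ge_1) (simp add: Suc_le_eq)
  \<comment> \<open>The choice \<open>S = {}\<close> compares the empty product 1 with the product
    of all \<open>n i\<close>.\<close>
  then have "1 \<le> min (\<Prod>i\<in>{}. n i) (\<Prod>i\<in>{..<k} - {}. n i)"
    by simp
  also have "\<dots> \<le> n_star k n"
    unfolding n_star_def by (intro Max_ge imageI) auto
  finally show ?thesis .
qed

lemma homogeneous_imp_vars_nonempty:
  assumes "homogeneous d p" "d \<ge> 1" "p \<noteq> 0"
  shows "vars p \<noteq> {}"
proof -
  obtain m where m: "m \<in> keys p"
    using \<open>p \<noteq> 0\<close> by (meson all_not_in_conv keys_eq_empty)
  then have "(\<Sum>v\<in>keys m. lookup m v) = d"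
    using assms(1) by (simp add: homogeneous_def)
  then have "keys m \<noteq> {}"
    using assms(2) by auto
  then show ?thesis
    using m by (auto simp: vars_def)
qed

section \<open>Generic points of maximal rank\<close>

lemma eventually_poly_nonzero:
  fixes Q :: "real poly"
  assumes "Q \<noteq> 0"
  shows "\<forall>\<^sub>F t in at a. poly Q t \<noteq> 0"
proof -
  have "\<not> a islimpt {t. poly Q t = 0}"
    using poly_roots_finite[OF assms] islimpt_finite by blast
  then show ?thesis
    by (simp add: islimpt_iff_eventually)
qed

text \<open>On the line from a point \<open>x0\<close> of maximal rank to a point \<open>x1\<close>
  outside the zero set, both properties hold for all small \<open>t \<noteq> 0\<close>: the
  polynomial has finitely many roots on that line, and rank is lower semicontinuous at
  \<open>x0\<close>.\<close>

lemma generic_point_of_maximal_rank: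
  fixes E :: "('v \<Rightarrow> real) \<Rightarrow> real^'n^'m"
  assumes "generically V P"
    and cont: "\<And>x y. ((\<lambda>t. E (\<lambda>v. x v + t * y v)) \<longlongrightarrow> E x) (at (0::real))"
  obtains x where "P x" "\<And>y. rank (E y) \<le> rank (E x)"
proof -
  obtain q where q: "q \<noteq> 0" "\<And>x. peval x q \<noteq> 0 \<Longrightarrow> P x"
    using assms(1) unfolding generically_def by blast
  obtain x1 where x1: "peval x1 q \<noteq> 0"
    using peval_nonzero[OF q(1)] .
  have "rank (E y) < Suc (min CARD('m) CARD('n))" for y
    using rank_bound[of "E y"] by (simp only: less_Suc_eq_le)
  then obtain x0 where x0: "\<And>y. rank (E y) \<le> rank (E x0)"
    using ex_has_greatest_nat[of "\<lambda>_. True" _ "\<lambda>x. rank (E x)" "Suc (min CARD('m) CARD('n))"]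
    by auto
  define x where "x t = (\<lambda>v. x0 v + t * (x1 v - x0 v))" for t
  obtain Q where Q: "\<And>t. poly Q t = peval (x t) q"
    using peval_on_line[of x0 "\<lambda>v. x1 v - x0 v" q] unfolding x_def by metis
  have "poly Q 1 \<noteq> 0"
    using x1 by (simp add: Q x_def)
  then have "\<forall>\<^sub>F t in at 0. poly Q t \<noteq> 0"
    by (intro eventually_poly_nonzero) auto
  moreover have "\<forall>\<^sub>F t in at 0. rank (E x0) \<le> rank (E (x t))"
    unfolding x_def by (intro eventually_rank_ge cont)
  ultimately have "\<forall>\<^sub>F t in at 0. P (x t) \<and> rank (E x0) \<le> rank (E (x t))"
    by eventually_elim (simp add: Q q(2))
  then obtain t where "P (x t)" "rank (E x0) \<le> rank (E (x t))"
    using eventually_happens[of _ "at (0::real)"] by auto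
  then show ?thesis
    using that[of "x t"] x0 order_trans by blast
qed

theorem theorem2p13:
  fixes k d r :: nat
    and n :: "nat \<Rightarrow> nat"
    and M :: "(nat \<Rightarrow> nat) rpoly ^ 'n2 ^ 'n1"
    and Mrep Mt :: "(nat \<times> (nat \<Rightarrow> nat)) rpoly ^ 'n2 ^ 'n1"
  assumes "d \<ge> 1"
    and "M \<noteq> 0"
    and "\<And>i j. vars (M $ i $ j) \<subseteq> multi_indices k n"
    and "\<And>i j. homogeneous d (M $ i $ j)"
    and "tensor_decomposition d r (multi_indices k n) M Mrep Mt"
    and "generically {(i, l, j). i < k \<and> l < r \<and> j < n i}
      (\<lambda>x. let T = (\<lambda>l. rank_one_tensor k (\<lambda>i j. x (i, l, j))) in
        rank (\<Sum>l\<in>increasing_tuples d r. map_matrix (peval (\<lambda>(s, j). T (l s) j)) Mt)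
          = (r choose d) * rank (map_matrix (peval (\<lambda>(s, j). T s j)) Mt))"
  shows "r \<le> 4 ^ k * d\<^sup>2 * n_star k n"
proof -
  let ?J = "multi_indices k n"
  obtain i0 j0 where M0: "M $ i0 $ j0 \<noteq> 0"
    using \<open>M \<noteq> 0\<close> by (auto simp: vec_eq_iff)
  then have "?J \<noteq> {}"
    using homogeneous_imp_vars_nonempty[OF assms(4) assms(1)] assms(3) by blast
  then have n1: "n_star k n \<ge> 1"
    by (rule n_star_ge_1)
  \<comment> \<open>The argument gives \<open>r \<le> 2 ^ k * n_star k n + (d - 1)\<close>. Since
    \<open>n_star k n \<ge> 1\<close>, the term \<open>d - 1\<close> is absorbed into a factor
    \<open>d\<close>, and the claimed bound is coarser still.\<close>
  have arith: "r \<le> 4 ^ k * d\<^sup>2 * n_star k n" if "r < 2 ^ k * n_star k n + d"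
  proof -
    have "r \<le> 2 ^ k * n_star k n + (d - 1) * 1"
      using that assms(1) by simp
    also have "\<dots> \<le> 2 ^ k * n_star k n + (d - 1) * (2 ^ k * n_star k n)"
      using n1 by (intro add_left_mono mult_left_mono) auto
    also have "\<dots> = 2 ^ k * d * n_star k n"
      using assms(1) by (cases d) (auto simp: algebra_simps)
    also have "\<dots> \<le> 4 ^ k * d\<^sup>2 * n_star k n"
      by (intro mult_mono power_mono) (auto simp: power2_eq_square)
    finally show ?thesis .
  qed
  show ?thesis
  proof (cases "r < d")
    case True
    then show ?thesis
      by (intro arith) simp
  next
    case False
    then have dr: "d \<le> r"
      by simp
    have hom: "multi_homogeneous_1 d ?J (Mt $ i $ j)" for i j
      using assms(5) by (simp add: tensor_decomposition_def)
    define E where "E a = map_matrix (peval (\<lambda>(s, j). rank_one_tensor k (a s) j)) Mt"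
      for a :: "nat \<Rightarrow> nat \<Rightarrow> nat \<Rightarrow> real"
    \<comment> \<open>Generic coordinates are addressed by mode, tensor and entry, whereas
      \<open>E\<close> takes the tensor first.\<close>
    define coords where "coords x s i j = x (i, s, j)"
      for x :: "nat \<times> nat \<times> nat \<Rightarrow> real" and s i j :: nat
    have cont: "((\<lambda>t. E (coords (\<lambda>v. x v + t * y v))) \<longlongrightarrow> E (coords x)) (at (0::real))" for x y
    proof (intro vec_tendstoI)
      fix i j
      \<comment> \<open>The limit is written with \<open>0 * y v\<close> so that it has the shape of
        the moving point, as the limit rules require.\<close>
      have *: "((\<lambda>t. \<Prod>i<k. coords (\<lambda>v. x v + t * y v) s i (w i)) \<longlongrightarrow>
          (\<Prod>i<k. coords (\<lambda>v. x v + 0 * y v) s i (w i))) (at (0::real))" for s w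
        unfolding coords_def by (intro tendsto_intros)
      then show "((\<lambda>t. E (coords (\<lambda>v. x v + t * y v)) $ i $ j) \<longlongrightarrow> E (coords x) $ i $ j) (at (0::real))"
        unfolding E_def nth_map_matrix
        by (intro tendsto_peval) (auto simp: rank_one_tensor_def)
    qed
    obtain x where x: "rank (\<Sum>l\<in>increasing_tuples d r. E (\<lambda>s. coords x (l s)))
        = (r choose d) * rank (E (coords x))"
      and max: "\<And>y. rank (E (coords y)) \<le> rank (E (coords x))"
      by (rule generic_point_of_maximal_rank[OF assms(6), where E = "\<lambda>x. E (coords x)"])
        (use cont in \<open>auto simp: E_def coords_def[abs_def] Let_def\<close>)
    define a where "a = coords x"
    define \<rho> where "\<rho> = rank (E a)"
    \<comment> \<open>Every family of components comes from some coordinates, so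
      \<open>\<rho>\<close> is maximal among all families.\<close>
    have "b = coords (\<lambda>(i, s, j). b s i j)" for b
      by (simp add: coords_def[abs_def])
    then have \<rho>: "rank (E b) \<le> \<rho>" for b
      unfolding \<rho>_def a_def by (metis max)
    \<comment> \<open>Otherwise \<open>Mt\<close> vanishes at all rank-one tensors, so its entry at
      \<open>i0\<close>, \<open>j0\<close> is the zero polynomial. The expansion of the nonzero
      entry \<open>M $ i0 $ j0\<close> would then involve fewer than \<open>d\<close> tensors in
      each monomial, which is impossible for \<open>d \<le> r\<close>.\<close>
    have "\<rho> \<noteq> 0"
    proof
      assume "\<rho> = 0"
      then have E0: "E b = 0" for b
        using \<rho>[of b] rank_eq_0 by auto
      have "Mt $ i0 $ j0 = 0"
      proof (rule ccontr)
        assume "Mt $ i0 $ j0 \<noteq> 0"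
        then obtain b where "peval (\<lambda>(s, j). rank_one_tensor k (b s) j) (Mt $ i0 $ j0) \<noteq> 0"
          using multi_homogeneous_1_nonzero_at_rank_one[OF hom] by blast
        then show False
          using E0[of b] by (auto simp: E_def vec_eq_iff)
      qed
      moreover have "expand_sum r (M $ i0 $ j0)
          = Mrep $ i0 $ j0 + (\<Sum>l\<in>increasing_tuples d r. select_tensors l (Mt $ i0 $ j0))"
        using assms(5) by (simp add: tensor_decomposition_def vec_eq_iff)
      ultimately have "expand_sum r (M $ i0 $ j0) = Mrep $ i0 $ j0"
        by (simp add: select_tensors_def psubst_def)
      then have "involves_fewer_tensors d r ?J (expand_sum r (M $ i0 $ j0))"
        using assms(5) by (simp add: tensor_decomposition_def)
      then show False
        using expand_sum_involves_fewer_tensors_imp_0[OF assms(4) dr] M0 by blast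
    qed
    \<comment> \<open>The tuple \<open>(0, ..., d - 2, l)\<close>, which is increasing for
      \<open>l\<close> from \<open>d - 1\<close> to \<open>r - 1\<close>.\<close>
    define tup where "tup l = restrict (\<lambda>s. if s = d - 1 then l else s) {..<d}" for l :: nat
    define F where "F b = E (\<lambda>s. if s = d - 1 then b else a s)" for b
    have inj: "inj_on tup {d - 1..<r}"
      using assms(1) by (auto simp: tup_def inj_on_def fun_eq_iff restrict_def dest!: spec[of _ "d - 1"])
    have tup: "tup ` {d - 1..<r} \<subseteq> increasing_tuples d r"
      using dr by (auto simp: tup_def increasing_tuples_def strict_mono_on_def split: if_splits)
    \<comment> \<open>Outside \<open>{..<d}\<close> the value of \<open>tup l\<close> is
      \<open>undefined\<close>, but the entries of \<open>Mt\<close> contain only the tensors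
      \<open>s < d\<close>.\<close>
    have "E (\<lambda>s. a (tup l s)) = F (a l)" for l
    proof -
      have "peval (\<lambda>(s, j). rank_one_tensor k (a (tup l s)) j) (Mt $ i $ j)
          = peval (\<lambda>(s, j). rank_one_tensor k (if s = d - 1 then a l else a s) j) (Mt $ i $ j)" for i j
        using hom[of i j] by (intro peval_cong) (auto simp: multi_homogeneous_1_def tup_def)
      then show ?thesis
        by (simp add: F_def E_def vec_eq_iff)
    qed
    then have sum_F: "(\<Sum>l\<in>tup ` {d - 1..<r}. E (\<lambda>s. a (l s))) = (\<Sum>l\<in>{d - 1..<r}. F (a l))"
      by (subst sum.reindex[OF inj]) simp
    \<comment> \<open>The full sum attains the largest rank that its summands allow, and this passes
      to the chosen partial sum.\<close>
    have "card (tup ` {d - 1..<r}) * \<rho> \<le> rank (\<Sum>l\<in>tup ` {d - 1..<r}. E (\<lambda>s. a (l s)))"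
    proof (rule rank_subsum_ge[OF finite_increasing_tuples tup \<rho>])
      show "card (increasing_tuples d r) * \<rho> \<le> rank (\<Sum>l\<in>increasing_tuples d r. E (\<lambda>s. a (l s)))"
        using x card_increasing_tuples_le[of d r] unfolding a_def \<rho>_def by simp
    qed
    also have "\<dots> \<le> 2 ^ k * n_star k n * \<rho>"
      unfolding sum_F
    proof (rule rank_sum_multilinear_matrices_le)
      show "rank (F b) \<le> \<rho>" for b
        unfolding F_def by (rule \<rho>)
      \<comment> \<open>Only tensor \<open>d - 1\<close> varies, and \<open>Mt\<close> has degree 1
        in it; a linear form evaluated at a rank-one tensor is multilinear in the
        components.\<close>
      have "\<exists>c. \<forall>b. F b $ i $ j = (\<Sum>w\<in>?J. rank_one_tensor k b w * c w)" for i j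
      proof -
        define y where "y = (\<lambda>(s, w). rank_one_tensor k (a s) w)"
        have "d - 1 < d"
          using assms(1) by simp
        then obtain c where c: "\<And>t. peval (\<lambda>(s, w). if s = d - 1 then t w else y (s, w)) (Mt $ i $ j)
            = (\<Sum>w\<in>?J. t w * c w)"
          using multi_homogeneous_1_linear[where y = y, OF hom finite_multi_indices] by blast
        have "(\<lambda>(s, w). rank_one_tensor k (if s = d - 1 then b else a s) w)
            = (\<lambda>(s, w). if s = d - 1 then rank_one_tensor k b w else y (s, w))" for b
          by (auto simp: y_def fun_eq_iff)
        then have "F b $ i $ j = (\<Sum>w\<in>?J. rank_one_tensor k b w * c w)" for b
          using c[of "rank_one_tensor k b"] by (simp only: F_def E_def nth_map_matrix)
        then show ?thesis
          by blast
      qed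
      then obtain c where c: "\<And>i j b. F b $ i $ j = (\<Sum>w\<in>?J. rank_one_tensor k b w * c i j w)"
        by metis
      show "multilinear_in {..<k} n F"
        unfolding multilinear_in_def
        by (intro exI[of _ "\<lambda>w. \<chi> i j. c i j w"])
          (simp add: vec_eq_iff c rank_one_tensor_def multi_indices_def)
    qed
    \<comment> \<open>There are \<open>r - (d - 1)\<close> chosen tuples, and the positive factor
      \<open>\<rho>\<close> cancels.\<close>
    finally have "r - (d - 1) \<le> 2 ^ k * n_star k n"
      unfolding card_image[OF inj] using \<open>\<rho> \<noteq> 0\<close> by simp
    then show ?thesis
      using assms(1) by (intro arith) linarith
  qed
qed

end
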